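(* Let $\bar M$ be a saturated structure (a saturated model of an arbitrary first-order theory), and let $(V,W,R)$ be a bipartite graph definable (with parameters) in $\bar M$, with $V,W$ definable sets and edge relation $R(x,y)\subseteq V\times W$, such that $R(x,y)$ is stable. Let $\mu$ be a global Keisler measure on $V$ and $\nu$ a global Keisler measure on $W$. Then for every $\epsilon>0$ we can partition $V$ into finitely many definable sets $V_1,\dots,V_m$, each defined by a $\Delta$-formula, and partition $W$ into finitely many definable sets $W_1,\dots,W_n$, each defined by a $\Delta^*$-formula, such that for each pair $V_i,W_j$ exactly one of the following holds: (i) for all $a\in V_i$ outside a set of $\mu$-measure $\le \epsilon\mu(V_i)$, for all $b\in W_j$ outside a set of $\nu$-measure $\le\epsilon\nu(W_j)$, we have $R(a,b)$; AND dually, for all $b\in W_j$ outside a set of $\nu$-measure $\le \epsilon\nu(W_j)$, for all $a\in V_i$ outside a set of $\mu$-measure $\le\epsilon\mu(V_i)$, we have $R(a,b)$; (ii) for all $a\in V_i$ outside a set of $\mu$-measure $\le \epsilon\mu(V_i)$, for all $b\in W_j$ outside a set of $\nu$-measure $\le\epsilon\nu(W_j)$, we have $\neg R(a,b)$; AND dually, for all $b\in W_j$ outside a set of $\nu$-measure $\le \epsilon\nu(W_j)$, for all $a\in V_i$ outside a set of $\mu$-measure $\le\epsilon\mu(V_i)$, we have $\neg R(a,b)$.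
   Context: Stability of $R$ means: for some $k$ there do not exist $a_i\in V$, $b_i\in W$ ($i\le k$) such that $R(a_i,b_j)$ holds iff $i\le j$. A global Keisler measure on $V$ is a finitely additive probability measure on the Boolean algebra of all subsets of $V$ definable with parameters in $\bar M$ (similarly for $W$). A $\Delta$-formula is a finite Boolean combination of formulas of the form $R(x,b)$ (with $b\in W$) and $x=a$ (with $a\in V$), with $x$ restricted to $V$, so it defines a subset of $V$. A $\Delta^*$-formula is a finite Boolean combination of formulas of the form $R(a,y)$ (with $a\in V$) and $y=b$ (with $b\in W$), with $y$ restricted to $W$, so it defines a subset of $W$.
   Formalization: For every ε>0 at least one of (i), (ii) is asserted for each pair; "exactly one" is asserted only for ε<1, since for ε≥1 the whole of V_i and W_j may be taken as exceptional sets, so both (i) and (ii) always hold. *)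

theory Defs
  imports "HOL-Analysis.Analysis"
begin

record ('f, 'r) language =
  fun_syms :: "'f set"
  rel_syms :: "'r set"
  fun_arity :: "'f \<Rightarrow> nat"
  rel_arity :: "'r \<Rightarrow> nat"

record ('f, 'r, 'm) struct =
  univ :: "'m set"
  fun_int :: "'f \<Rightarrow> 'm list \<Rightarrow> 'm"
  rel_int :: "'r \<Rightarrow> 'm list \<Rightarrow> bool"

definition is_structure :: "('f, 'r) language \<Rightarrow> ('f, 'r, 'm) struct \<Rightarrow> bool" where
  "is_structure L M \<longleftrightarrow> univ M \<noteq> {} \<and>
     (\<forall>f\<in>fun_syms L. \<forall>xs. length xs = fun_arity L f \<and> set xs \<subseteq> univ M \<longrightarrow> fun_int M f xs \<in> univ M)"

text \<open>\<open>Param a\<close> is the constant naming the element \<open>a\<close>, so that formulas with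
  \<open>params \<phi> \<subseteq> A\<close> are the formulas with parameters in \<open>A\<close>.\<close>

datatype (tm_funs: 'f, tm_params: 'm) tm =
  Var nat
| Param 'm
| App 'f "('f, 'm) tm list"

datatype (funs: 'f, rels: 'r, params: 'm) fm =
  Equal "('f, 'm) tm" "('f, 'm) tm"
| Rel 'r "('f, 'm) tm list"
| Neg "('f, 'r, 'm) fm"
| Conj "('f, 'r, 'm) fm" "('f, 'r, 'm) fm"
| Exi nat "('f, 'r, 'm) fm"

fun wf_tm :: "('f, 'r) language \<Rightarrow> ('f, 'm) tm \<Rightarrow> bool" where
  "wf_tm L (Var i) \<longleftrightarrow> True"
| "wf_tm L (Param a) \<longleftrightarrow> True"
| "wf_tm L (App f ts) \<longleftrightarrow> f \<in> fun_syms L \<and> length ts = fun_arity L f \<and> (\<forall>t\<in>set ts. wf_tm L t)"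

fun wf_fm :: "('f, 'r) language \<Rightarrow> ('f, 'r, 'm) fm \<Rightarrow> bool" where
  "wf_fm L (Equal s t) \<longleftrightarrow> wf_tm L s \<and> wf_tm L t"
| "wf_fm L (Rel r ts) \<longleftrightarrow> r \<in> rel_syms L \<and> length ts = rel_arity L r \<and> (\<forall>t\<in>set ts. wf_tm L t)"
| "wf_fm L (Neg \<phi>) \<longleftrightarrow> wf_fm L \<phi>"
| "wf_fm L (Conj \<phi> \<psi>) \<longleftrightarrow> wf_fm L \<phi> \<and> wf_fm L \<psi>"
| "wf_fm L (Exi i \<phi>) \<longleftrightarrow> wf_fm L \<phi>"

fun tm_vars :: "('f, 'm) tm \<Rightarrow> nat set" where
  "tm_vars (Var i) = {i}"
| "tm_vars (Param a) = {}"
| "tm_vars (App f ts) = (\<Union>t\<in>set ts. tm_vars t)"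

fun free_vars :: "('f, 'r, 'm) fm \<Rightarrow> nat set" where
  "free_vars (Equal s t) = tm_vars s \<union> tm_vars t"
| "free_vars (Rel r ts) = (\<Union>t\<in>set ts. tm_vars t)"
| "free_vars (Neg \<phi>) = free_vars \<phi>"
| "free_vars (Conj \<phi> \<psi>) = free_vars \<phi> \<union> free_vars \<psi>"
| "free_vars (Exi i \<phi>) = free_vars \<phi> - {i}"

fun tm_val :: "('f, 'r, 'm) struct \<Rightarrow> (nat \<Rightarrow> 'm) \<Rightarrow> ('f, 'm) tm \<Rightarrow> 'm" where
  "tm_val M e (Var i) = e i"
| "tm_val M e (Param a) = a"
| "tm_val M e (App f ts) = fun_int M f (map (tm_val M e) ts)"

fun sat :: "('f, 'r, 'm) struct \<Rightarrow> (nat \<Rightarrow> 'm) \<Rightarrow> ('f, 'r, 'm) fm \<Rightarrow> bool" where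
  "sat M e (Equal s t) \<longleftrightarrow> tm_val M e s = tm_val M e t"
| "sat M e (Rel r ts) \<longleftrightarrow> rel_int M r (map (tm_val M e) ts)"
| "sat M e (Neg \<phi>) \<longleftrightarrow> \<not> sat M e \<phi>"
| "sat M e (Conj \<phi> \<psi>) \<longleftrightarrow> sat M e \<phi> \<and> sat M e \<psi>"
| "sat M e (Exi i \<phi>) \<longleftrightarrow> (\<exists>a\<in>univ M. sat M (e(i := a)) \<phi>)"

definition formulas_over :: "('f, 'r) language \<Rightarrow> 'm set \<Rightarrow> nat \<Rightarrow> ('f, 'r, 'm) fm set" where
  "formulas_over L A n = {\<phi>. wf_fm L \<phi> \<and> params \<phi> \<subseteq> A \<and> free_vars \<phi> \<subseteq> {..<n}}"

text \<open>Tuples are lists. The tuple \<open>a\<close> is assigned to the variables \<open>0, \<dots>, n - 1\<close>; the junk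
  value of \<open>a ! i\<close> for \<open>i \<ge> n\<close> is irrelevant, as these variables are not free.\<close>

definition definable :: "('f, 'r) language \<Rightarrow> ('f, 'r, 'm) struct \<Rightarrow> nat \<Rightarrow> 'm list set \<Rightarrow> bool" where
  "definable L M n X \<longleftrightarrow> (\<exists>\<phi>\<in>formulas_over L (univ M) n.
     X = {a. length a = n \<and> set a \<subseteq> univ M \<and> sat M (\<lambda>i. a ! i) \<phi>})"

definition definable_rel ::
  "('f, 'r) language \<Rightarrow> ('f, 'r, 'm) struct \<Rightarrow> nat \<Rightarrow> nat \<Rightarrow> ('m list \<times> 'm list) set \<Rightarrow> bool" where
  "definable_rel L M n k R \<longleftrightarrow> R \<subseteq> {a. length a = n} \<times> {b. length b = k} \<and>
     definable L M (n + k) {a @ b |a b. (a, b) \<in> R}"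

text \<open>Saturated means saturated in its own cardinality: every type in one variable over a
  parameter set of size less than that of the structure is realised.\<close>

definition finitely_satisfiable :: "('f, 'r, 'm) struct \<Rightarrow> ('f, 'r, 'm) fm set \<Rightarrow> bool" where
  "finitely_satisfiable M p \<longleftrightarrow>
     (\<forall>q. finite q \<and> q \<subseteq> p \<longrightarrow> (\<exists>a\<in>univ M. \<forall>\<phi>\<in>q. sat M (\<lambda>_. a) \<phi>))"

definition saturated :: "('f, 'r) language \<Rightarrow> ('f, 'r, 'm) struct \<Rightarrow> bool" where
  "saturated L M \<longleftrightarrow>
     (\<forall>A p. A \<subseteq> univ M \<and> A \<prec> univ M \<and> p \<subseteq> formulas_over L A 1 \<and> finitely_satisfiable M p
        \<longrightarrow> (\<exists>a\<in>univ M. \<forall>\<phi>\<in>p. sat M (\<lambda>_. a) \<phi>))"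

definition definable_subsets ::
  "('f, 'r) language \<Rightarrow> ('f, 'r, 'm) struct \<Rightarrow> nat \<Rightarrow> 'm list set \<Rightarrow> 'm list set set" where
  "definable_subsets L M n V = {X. X \<subseteq> V \<and> definable L M n X}"

definition keisler_measure ::
  "('f, 'r) language \<Rightarrow> ('f, 'r, 'm) struct \<Rightarrow> nat \<Rightarrow> 'm list set \<Rightarrow> ('m list set \<Rightarrow> real) \<Rightarrow> bool" where
  "keisler_measure L M n V \<mu> \<longleftrightarrow>
     (\<forall>X\<in>definable_subsets L M n V. 0 \<le> \<mu> X) \<and> \<mu> V = 1 \<and> additive (definable_subsets L M n V) \<mu>"

definition stable_rel :: "'a set \<Rightarrow> 'b set \<Rightarrow> ('a \<times> 'b) set \<Rightarrow> bool" where
  "stable_rel V W R \<longleftrightarrow> (\<exists>k::nat. \<not> (\<exists>a b. (\<forall>i\<in>{1..k}. a i \<in> V \<and> b i \<in> W) \<and>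
     (\<forall>i\<in>{1..k}. \<forall>j\<in>{1..k}. (a i, b j) \<in> R \<longleftrightarrow> i \<le> j)))"

inductive_set boolean_combinations :: "'a set \<Rightarrow> 'a set set \<Rightarrow> 'a set set"
  for U :: "'a set" and G :: "'a set set" where
  gen: "X \<in> G \<Longrightarrow> X \<in> boolean_combinations U G"
| compl: "X \<in> boolean_combinations U G \<Longrightarrow> U - X \<in> boolean_combinations U G"
| inter: "X \<in> boolean_combinations U G \<Longrightarrow> Y \<in> boolean_combinations U G \<Longrightarrow>
    X \<inter> Y \<in> boolean_combinations U G"
| union: "X \<in> boolean_combinations U G \<Longrightarrow> Y \<in> boolean_combinations U G \<Longrightarrow>
    X \<union> Y \<in> boolean_combinations U G"

definition Delta_sets :: "'a set \<Rightarrow> 'b set \<Rightarrow> ('a \<times> 'b) set \<Rightarrow> 'a set set" where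
  "Delta_sets V W R =
     boolean_combinations V ({{x \<in> V. (x, b) \<in> R} |b. b \<in> W} \<union> {{x \<in> V. x = a} |a. a \<in> V})"

definition Delta_star_sets :: "'a set \<Rightarrow> 'b set \<Rightarrow> ('a \<times> 'b) set \<Rightarrow> 'b set set" where
  "Delta_star_sets V W R =
     boolean_combinations W ({{y \<in> W. (a, y) \<in> R} |a. a \<in> V} \<union> {{y \<in> W. y = b} |b. b \<in> W})"

text \<open>\<open>almost_all D \<mu> \<epsilon> X P\<close>: for all \<open>a \<in> X\<close> outside a set of \<open>\<mu>\<close>-measure at most
  \<open>\<epsilon> * \<mu> X\<close>, \<open>P a\<close> holds. Here \<open>D\<close> is the domain of \<open>\<mu>\<close>. If \<open>\<epsilon> \<ge> 1\<close> or \<open>\<mu> X = 0\<close>, then \<open>X\<close>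
  itself is an admissible exceptional set and the condition holds for every \<open>P\<close>.\<close>

definition almost_all :: "'a set set \<Rightarrow> ('a set \<Rightarrow> real) \<Rightarrow> real \<Rightarrow> 'a set \<Rightarrow> ('a \<Rightarrow> bool) \<Rightarrow> bool" where
  "almost_all D \<mu> \<epsilon> X P \<longleftrightarrow> (\<exists>E\<in>D. \<mu> E \<le> \<epsilon> * \<mu> X \<and> (\<forall>a\<in>X - E. P a))"

definition almost_all_pairs ::
  "'a set set \<Rightarrow> ('a set \<Rightarrow> real) \<Rightarrow> 'b set set \<Rightarrow> ('b set \<Rightarrow> real) \<Rightarrow> real \<Rightarrow>
     'a set \<Rightarrow> 'b set \<Rightarrow> ('a \<Rightarrow> 'b \<Rightarrow> bool) \<Rightarrow> bool" where
  "almost_all_pairs D \<mu> D' \<nu> \<epsilon> X Y Q \<longleftrightarrow>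
     almost_all D \<mu> \<epsilon> X (\<lambda>a. almost_all D' \<nu> \<epsilon> Y (\<lambda>b. Q a b)) \<and>
     almost_all D' \<nu> \<epsilon> Y (\<lambda>b. almost_all D \<mu> \<epsilon> X (\<lambda>a. Q a b))"

end

theory Submission
  imports Defs "HOL-Library.Ramsey"
begin

text \<open>Let \<open>A\<close> be the Boolean algebra on \<open>V\<close> generated by the sets \<open>R(x,b)\<close>, and call its ultrafilters
  types. Stability has three consequences. Every type \<open>p\<close> is definable: \<open>{b. R(x,b) \<in> p}\<close> is a finite
  Boolean combination of sets \<open>R(a,y)\<close>. There are too few types for a full binary tree, so every
  nonzero finitely additive measure on \<open>A\<close> has an atom, and hence \<open>\<mu>\<close> is a countable weighted sum of
  types. Finally, the definition of a type \<open>p\<close> on \<open>V\<close> belongs to a type \<open>q\<close> on \<open>W\<close> iff the definition of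
  \<open>q\<close> belongs to \<open>p\<close> (Harrington).

  Choose finitely many types of positive mass carrying almost all of \<open>\<mu>\<close>, separate them by
  sets whose measure is concentrated on the chosen type, and add the small remainder to the piece of
  a type fixed in advance; do the same for \<open>\<nu>\<close>. A pair of pieces with types \<open>p\<close>, \<open>q\<close> is then almost
  complete or almost empty according to whether the definition of \<open>q\<close> belongs to \<open>p\<close>.\<close>

section \<open>Stable relations\<close>

text \<open>Reversing the indices of a ladder exchanges the roles of its two sides, so the same
  bound \<open>k\<close> serves.\<close>

lemma stable_rel_converse:
  assumes "stable_rel V W R"
  shows "stable_rel W V (R\<inverse>)"
proof -
  obtain k :: nat where k: "\<not> (\<exists>a b. (\<forall>i\<in>{1..k}. a i \<in> V \<and> b i \<in> W) \<and>
     (\<forall>i\<in>{1..k}. \<forall>j\<in>{1..k}. (a i, b j) \<in> R \<longleftrightarrow> i \<le> j))"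
    using assms unfolding stable_rel_def by blast
  have False
    if m: "\<forall>i\<in>{1..k}. a i \<in> W \<and> b i \<in> V" and l: "\<forall>i\<in>{1..k}. \<forall>j\<in>{1..k}. (a i, b j) \<in> R\<inverse> \<longleftrightarrow> i \<le> j" for a b
  proof -
    have r: "k + 1 - i \<in> {1..k}" if "i \<in> {1..k}" for i using that by auto
    have "(b (k + 1 - i), a (k + 1 - j)) \<in> R \<longleftrightarrow> i \<le> j" if "i \<in> {1..k}" "j \<in> {1..k}" for i j
      using l r[OF that(1)] r[OF that(2)] that by fastforce
    with m r have "\<exists>a b. (\<forall>i\<in>{1..k}. a i \<in> V \<and> b i \<in> W) \<and>
       (\<forall>i\<in>{1..k}. \<forall>j\<in>{1..k}. (a i, b j) \<in> R \<longleftrightarrow> i \<le> j)"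
      by (intro exI[of _ "\<lambda>i. b (k + 1 - i)"] exI[of _ "\<lambda>j. a (k + 1 - j)"]) blast
    with k show False by blast
  qed
  then show ?thesis unfolding stable_rel_def by blast
qed

text \<open>An infinite ladder contains ladders of every finite length. This is the form in which
  the sequences built by dependent choice contradict stability.\<close>

lemma stable_rel_no_ladder:
  fixes a :: "nat \<Rightarrow> 'a" and b :: "nat \<Rightarrow> 'b"
  assumes "stable_rel V W R" "\<And>i. a i \<in> V" "\<And>i. b i \<in> W"
    "\<And>i j. (a i, b j) \<in> R \<longleftrightarrow> i \<le> j"
  shows False
  using assms unfolding stable_rel_def by blast

lemma stable_rel_subset:
  assumes "stable_rel V W R" "V' \<subseteq> V" "W' \<subseteq> W"
  shows "stable_rel V' W' R"
proof -
  obtain k :: nat where k: "\<not> (\<exists>a b. (\<forall>i\<in>{1..k}. a i \<in> V \<and> b i \<in> W) \<and>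
     (\<forall>i\<in>{1..k}. \<forall>j\<in>{1..k}. (a i, b j) \<in> R \<longleftrightarrow> i \<le> j))"
    using assms(1) unfolding stable_rel_def by blast
  show ?thesis
    unfolding stable_rel_def
  proof (intro exI[of _ k] notI, elim exE conjE)
    fix a b
    assume "\<forall>i\<in>{1..k}. a i \<in> V' \<and> b i \<in> W'"
      and l: "\<forall>i\<in>{1..k}. \<forall>j\<in>{1..k}. (a i, b j) \<in> R \<longleftrightarrow> i \<le> j"
    then have "\<forall>i\<in>{1..k}. a i \<in> V \<and> b i \<in> W" using assms(2,3) by auto
    with l have "\<exists>a b. (\<forall>i\<in>{1..k}. a i \<in> V \<and> b i \<in> W) \<and>
        (\<forall>i\<in>{1..k}. \<forall>j\<in>{1..k}. (a i, b j) \<in> R \<longleftrightarrow> i \<le> j)"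
      by (intro exI[of _ a] exI[of _ b] conjI)
    with k show False by (rule notE)
  qed
qed

text \<open>If no finite \<open>F\<close> works, one obtains sequences with \<open>R(a\<^sub>j,b\<^sub>i)\<close> and \<open>\<not> R(a\<^sub>j,c\<^sub>i)\<close> for
  \<open>i \<le> j\<close>, and \<open>R(a\<^sub>i,b\<^sub>j) \<longrightarrow> R(a\<^sub>i,c\<^sub>j)\<close> for \<open>i < j\<close>. By Ramsey's theorem, after thinning out
  either the \<open>c\<^sub>j\<close> or the \<open>b\<^sub>j\<close> form a ladder with the \<open>a\<^sub>i\<close>.\<close>

lemma stable_rel_trace_determines:
  assumes st: "stable_rel V W R"
    and approx: "\<And>B. finite B \<Longrightarrow> B \<subseteq> W \<Longrightarrow> \<exists>a\<in>V. \<forall>b\<in>B. (a, b) \<in> R \<longleftrightarrow> b \<in> D"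
  shows "\<exists>F. finite F \<and> F \<subseteq> V \<and>
    (\<forall>b\<in>W. \<forall>c\<in>W. b \<in> D \<longrightarrow> {a \<in> F. (a, b) \<in> R} \<subseteq> {a \<in> F. (a, c) \<in> R} \<longrightarrow> c \<in> D)"
proof (rule ccontr)
  assume "\<not> ?thesis"
  then have step: "\<exists>b\<in>W. \<exists>c\<in>W. b \<in> D \<and> c \<notin> D \<and> {a \<in> F. (a, b) \<in> R} \<subseteq> {a \<in> F. (a, c) \<in> R}"
    if "finite F" "F \<subseteq> V" for F using that by blast
  \<comment> \<open>\<open>r\<close> may follow the first \<open>n\<close> triples of
    \<open>f\<close>. Only values of \<open>f\<close> below \<open>n\<close> enter, as
    \<open>dependent_wf_choice\<close> demands.\<close>
  define ok where "ok f n r \<longleftrightarrow> (case r of (a, b, c) \<Rightarrow> a \<in> V \<and> b \<in> W \<and> c \<in> W \<and> b \<in> D \<and> c \<notin> D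
      \<and> (\<forall>i<n. (fst (f i), b) \<in> R \<longrightarrow> (fst (f i), c) \<in> R) \<and> (a, b) \<in> R \<and> (a, c) \<notin> R
      \<and> (\<forall>i<n. (a, fst (snd (f i))) \<in> R \<and> (a, snd (snd (f i))) \<notin> R))"
    for f :: "nat \<Rightarrow> 'a \<times> 'b \<times> 'b" and n r
  have "\<exists>f. \<forall>n. ok f n (f n)"
  proof (rule dependent_wf_choice[OF wf_less_than])
    fix f g :: "nat \<Rightarrow> 'a \<times> 'b \<times> 'b" and n r
    assume "\<And>z. (z, n) \<in> less_than \<Longrightarrow> f z = g z"
    then have "f i = g i" if "i < n" for i using that by simp
    then show "ok f n r = ok g n r" unfolding ok_def by (intro prod.case_cong refl) (metis (no_types, lifting))
  next
    fix n and f :: "nat \<Rightarrow> 'a \<times> 'b \<times> 'b"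
    assume ok: "\<And>y. (y, n) \<in> less_than \<Longrightarrow> ok f y (f y)"
    have IH: "fst (f i) \<in> V \<and> fst (snd (f i)) \<in> W \<and> snd (snd (f i)) \<in> W
        \<and> fst (snd (f i)) \<in> D \<and> snd (snd (f i)) \<notin> D" if "i < n" for i
      using ok[of i] that by (cases "f i") (simp add: ok_def)
    obtain b c where bc: "b \<in> W" "c \<in> W" "b \<in> D" "c \<notin> D"
      "{a \<in> (\<lambda>i. fst (f i)) ` {..<n}. (a, b) \<in> R} \<subseteq> {a \<in> (\<lambda>i. fst (f i)) ` {..<n}. (a, c) \<in> R}"
      using step[of "(\<lambda>i. fst (f i)) ` {..<n}"] IH by (auto simp: image_subset_iff)
    \<comment> \<open>The new \<open>b\<close> and \<open>c\<close> are included, so the relations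
      of \<open>a\<close> to them also hold at equal indices.\<close>
    define B where "B = {b, c} \<union> (\<lambda>i. fst (snd (f i))) ` {..<n} \<union> (\<lambda>i. snd (snd (f i))) ` {..<n}"
    have "finite B" "B \<subseteq> W" using bc IH by (auto simp: B_def)
    then obtain a where a: "a \<in> V" "\<forall>x\<in>B. (a, x) \<in> R \<longleftrightarrow> x \<in> D"
      using approx[of B] by blast
    have "ok f n (a, b, c)"
      using a bc IH unfolding ok_def B_def by (auto simp: subset_iff)
    then show "\<exists>r. ok f n r" ..
  qed
  then obtain f where f: "\<And>n. ok f n (f n)" by blast
  define a b c where "a i = fst (f i)" and "b i = fst (snd (f i))" and "c i = snd (snd (f i))" for i
  have in_VW: "a i \<in> V" "b i \<in> W" "c i \<in> W" for i
    using f[of i] by (auto simp: ok_def a_def b_def c_def split: prod.splits)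
  have imp: "(a i, b j) \<in> R \<Longrightarrow> (a i, c j) \<in> R" if "i < j" for i j
    using f[of j] that by (auto simp: ok_def a_def b_def c_def split: prod.splits)
  have low: "(a j, b i) \<in> R \<and> (a j, c i) \<notin> R" if "i \<le> j" for i j
    using f[of j] that by (cases "i = j") (auto simp: ok_def a_def b_def c_def split: prod.splits)
  \<comment> \<open>The colour of a pair \<open>i < j\<close> records whether \<open>a i\<close> is
    related to \<open>c j\<close>; \<open>Min\<close> and \<open>Max\<close> recover the
    order.\<close>
  define h where "h S = (if (a (Min S), c (Max S)) \<in> R then 1 else 0 :: nat)" for S
  obtain Y t where Y: "infinite Y" "\<forall>x\<in>Y. \<forall>y\<in>Y. x \<noteq> y \<longrightarrow> h {x, y} = t"
  proof -
    have "\<forall>x\<in>UNIV. \<forall>y\<in>UNIV. x \<noteq> y \<longrightarrow> h {x, y} < 2" by (simp add: h_def)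
    from Ramsey2[OF infinite_UNIV_nat this] that show thesis by blast
  qed
  define e where "e = enumerate Y"
  have less: "e i < e j \<longleftrightarrow> i < j" and le: "e i \<le> e j \<longleftrightarrow> i \<le> j" for i j
    using strict_mono_enumerate[OF Y(1)] by (simp_all add: e_def strict_mono_less strict_mono_less_eq)
  have "h {e i, e j} = t" if "i < j" for i j
  proof -
    have "e i \<in> Y" "e j \<in> Y" using Y(1) by (simp_all add: e_def enumerate_in_set)
    with Y(2) less[of i j] that show ?thesis by simp
  qed
  moreover have "h {e i, e j} = (if (a (e i), c (e j)) \<in> R then 1 else 0)" if "i < j" for i j
    using that less[of i j] by (simp add: h_def min_def max_def)
  ultimately have col: "(a (e i), c (e j)) \<in> R \<longleftrightarrow> t = 1" if "i < j" for i j
    using that by (metis zero_neq_one)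
  show False
  proof (cases "t = 1")
    case True
    \<comment> \<open>On the thinned sequence \<open>a\<close> is related to \<open>c\<close>
      exactly for strictly smaller indices. The shift by one makes the inequality weak.\<close>
    have "(a (e i), c (e (Suc j))) \<in> R \<longleftrightarrow> i \<le> j" for i j
      using col[of i "Suc j"] low[of "e (Suc j)" "e i"] le[of "Suc j" i] True by fastforce
    then show False by (rule stable_rel_no_ladder[OF st, rotated 2]) (auto simp: in_VW)
  next
    case False
    \<comment> \<open>Here \<open>a i\<close> is unrelated to \<open>c j\<close> for
      \<open>i < j\<close>, hence by \<open>imp\<close> also to \<open>b j\<close>. This leaves a
      ladder for the converse.\<close>
    have "(b (e i), a (e j)) \<in> R\<inverse> \<longleftrightarrow> i \<le> j" for i j
      using col[of j i] imp[of "e j" "e i"] low[of "e i" "e j"] le[of i j] less[of j i] False by fastforce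
    then show False by (rule stable_rel_no_ladder[OF stable_rel_converse[OF st], rotated 2]) (auto simp: in_VW)
  qed
qed

section \<open>Fibres and the impossibility of infinite splitting\<close>

definition fiber :: "'a set \<Rightarrow> ('a \<times> 'b) set \<Rightarrow> 'b \<Rightarrow> 'a set" where
  "fiber V R b = {x \<in> V. (x, b) \<in> R}"

text \<open>Otherwise the sets split along a full binary tree of infinite height. Each of its uncountably
  many branches is a type over the countable set of its nodes, and these types are determined by
  finite data from a countable set.\<close>

lemma stable_rel_unsplit:
  assumes st: "stable_rel V W R" and sub: "\<X> \<subseteq> Pow V" and ne: "{} \<notin> \<X>" and X0: "X\<^sub>0 \<in> \<X>"
  shows "\<exists>X\<in>\<X>. \<forall>b\<in>W. X \<inter> fiber V R b \<notin> \<X> \<or> X - fiber V R b \<notin> \<X>"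
proof (rule ccontr)
  assume "\<not> ?thesis"
  then obtain s where s: "\<And>X. X \<in> \<X> \<Longrightarrow> s X \<in> W \<and> X \<inter> fiber V R (s X) \<in> \<X> \<and> X - fiber V R (s X) \<in> \<X>"
    by metis
  \<comment> \<open>Nodes are lists of decisions, the latest one at the head.\<close>
  define T where "T = rec_list X\<^sub>0 (\<lambda>t (_::bool list) X. if t then X \<inter> fiber V R (s X) else X - fiber V R (s X))"
  have T_Nil: "T [] = X\<^sub>0" and T_Cons: "T (t # l) = (if t then T l \<inter> fiber V R (s (T l)) else T l - fiber V R (s (T l)))" for t l
    by (simp_all add: T_def)
  have T_in: "T l \<in> \<X>" for l
    by (induction l) (auto simp: T_Nil T_Cons X0 s)
  then have "\<exists>x. x \<in> T l" for l using ne by (metis all_not_in_conv)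
  then obtain a where a: "\<And>l. a l \<in> T l" by metis
  have aV: "range a \<subseteq> V" using a T_in sub by blast
  define b where "b l = s (T l)" for l
  have bW: "b l \<in> W" for l using s T_in b_def by simp
  \<comment> \<open>The node at depth \<open>n\<close> of the branch coded by
    \<open>\<sigma>\<close>: at level \<open>i\<close> the branch enters the fibre iff
    \<open>i \<in> \<sigma>\<close>.\<close>
  define path where "path \<sigma> = rec_nat [] (\<lambda>n l. (n \<in> \<sigma>) # l)" for \<sigma> :: "nat set"
  have path_0: "path \<sigma> 0 = []" and path_Suc: "path \<sigma> (Suc n) = (n \<in> \<sigma>) # path \<sigma> n" for \<sigma> n
    by (simp_all add: path_def)
  have branch: "x \<in> T (path \<sigma> m) \<Longrightarrow> n < m \<Longrightarrow> (x, b (path \<sigma> n)) \<in> R \<longleftrightarrow> n \<in> \<sigma>" for x \<sigma> n m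
  proof (induction m)
    case (Suc m)
    have "x \<in> T (path \<sigma> m)" "(x, b (path \<sigma> m)) \<in> R \<longleftrightarrow> m \<in> \<sigma>"
      using Suc.prems(1) T_in[of "path \<sigma> m"] sub by (auto simp: path_Suc T_Cons fiber_def b_def split: if_splits)
    with Suc show ?case by (cases "n = m") auto
  qed simp
  define D where "D \<sigma> = {b (path \<sigma> n) |n. n \<in> \<sigma>}" for \<sigma>
  \<comment> \<open>Labels may repeat along a branch. A point of a deeper node shows that equal
    labels were decided in the same way.\<close>
  have D_iff: "b (path \<sigma> n) \<in> D \<sigma> \<longleftrightarrow> n \<in> \<sigma>" for \<sigma> n
  proof
    assume "b (path \<sigma> n) \<in> D \<sigma>"
    then obtain m where m: "m \<in> \<sigma>" "b (path \<sigma> n) = b (path \<sigma> m)" by (auto simp: D_def)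
    then show "n \<in> \<sigma>"
      using branch[OF a, of n "Suc (max n m)" \<sigma>] branch[OF a, of m "Suc (max n m)" \<sigma>] by simp
  qed (auto simp: D_def)
  \<comment> \<open>Restricting the left side to \<open>range a\<close> makes the possible witnesses
    \<open>F\<close> countable in number.\<close>
  have "\<exists>F. finite F \<and> F \<subseteq> range a \<and> (\<forall>x\<in>range (\<lambda>n. b (path \<sigma> n)). \<forall>y\<in>range (\<lambda>n. b (path \<sigma> n)).
      x \<in> D \<sigma> \<longrightarrow> {a \<in> F. (a, x) \<in> R} \<subseteq> {a \<in> F. (a, y) \<in> R} \<longrightarrow> y \<in> D \<sigma>)" for \<sigma>
  proof (rule stable_rel_trace_determines)
    show "stable_rel (range a) (range (\<lambda>n. b (path \<sigma> n))) R"
      by (rule stable_rel_subset[OF st aV]) (simp add: image_subset_iff bW)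
    fix B assume "finite B" "B \<subseteq> range (\<lambda>n. b (path \<sigma> n))"
    then obtain N where N: "finite N" "B = (\<lambda>n. b (path \<sigma> n)) ` N"
      by (meson finite_subset_image)
    have "(a (path \<sigma> (Suc (Max N))), b (path \<sigma> n)) \<in> R \<longleftrightarrow> n \<in> \<sigma>" if "n \<in> N" for n
      using branch[OF a] N(1) that by (simp add: le_imp_less_Suc)
    then have "\<forall>b\<in>B. (a (path \<sigma> (Suc (Max N))), b) \<in> R \<longleftrightarrow> b \<in> D \<sigma>"
      using N(2) D_iff by simp
    then show "\<exists>a\<in>range a. \<forall>b\<in>B. (a, b) \<in> R \<longleftrightarrow> b \<in> D \<sigma>" by (rule bexI) simp
  qed
  then have "\<exists>F. finite F \<and> F \<subseteq> range a \<and> (\<forall>n m. n \<in> \<sigma> \<longrightarrow>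
      {a \<in> F. (a, b (path \<sigma> n)) \<in> R} \<subseteq> {a \<in> F. (a, b (path \<sigma> m)) \<in> R} \<longrightarrow> m \<in> \<sigma>)" for \<sigma>
    unfolding ball_simps D_iff all_simps .
  then obtain F where FF: "\<And>\<sigma>. finite (F \<sigma>) \<and> F \<sigma> \<subseteq> range a \<and> (\<forall>n m. n \<in> \<sigma> \<longrightarrow>
      {a \<in> F \<sigma>. (a, b (path \<sigma> n)) \<in> R} \<subseteq> {a \<in> F \<sigma>. (a, b (path \<sigma> m)) \<in> R} \<longrightarrow> m \<in> \<sigma>)"
    by moura
  have fin: "finite (F \<sigma>)" and Fa: "F \<sigma> \<subseteq> range a" for \<sigma>
    using FF[of \<sigma>] by simp_all
  have F: "m \<in> \<sigma>" if "n \<in> \<sigma>"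
      "{a \<in> F \<sigma>. (a, b (path \<sigma> n)) \<in> R} = {a \<in> F \<sigma>. (a, b (path \<sigma> m)) \<in> R}" for \<sigma> n m
    using FF[of \<sigma>] that by (metis (no_types, lifting) order_refl)
  \<comment> \<open>The code of a branch consists of its finite witness set and the traces on it of
    the labels decided positively. Traces are subsets of \<open>F \<sigma>\<close>, so there are
    finitely many.\<close>
  define c where "c \<sigma> = (F \<sigma>, (\<lambda>n. {a \<in> F \<sigma>. (a, b (path \<sigma> n)) \<in> R}) ` \<sigma>)" for \<sigma>
  have c_mem: "m \<in> \<sigma> \<longleftrightarrow> {a \<in> fst (c \<sigma>). (a, b (path \<sigma> m)) \<in> R} \<in> snd (c \<sigma>)" for m \<sigma>
    using F[of _ \<sigma> m] by (auto simp: c_def)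
  have "inj c"
  proof (rule injI)
    fix \<sigma> \<tau> assume eq: "c \<sigma> = c \<tau>"
    \<comment> \<open>If the paths agree up to depth \<open>n\<close>, they have the same label
      there, and equal codes decide it equally by \<open>c_mem\<close>.\<close>
    have "path \<sigma> n = path \<tau> n" for n
      by (induction n) (use c_mem[of _ \<sigma>] c_mem[of _ \<tau>] eq in \<open>simp_all add: path_0 path_Suc\<close>)
    then show "\<sigma> = \<tau>" by (metis path_Suc list.inject subsetI subset_antisym)
  qed
  moreover have "countable (range c)"
  proof (rule countable_subset)
    let ?C = "{F. F \<subseteq> range a \<and> finite F}"
    show "range c \<subseteq> ?C \<times> {S. S \<subseteq> ?C \<and> finite S}"
    proof
      fix x assume "x \<in> range c"
      then obtain \<sigma> where x: "x = c \<sigma>" by blast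
      have "snd (c \<sigma>) \<subseteq> Pow (F \<sigma>)" by (auto simp: c_def)
      moreover have "Pow (F \<sigma>) \<subseteq> ?C" using fin[of \<sigma>] Fa[of \<sigma>] by (auto intro: finite_subset)
      ultimately have "snd (c \<sigma>) \<subseteq> ?C \<and> finite (snd (c \<sigma>))"
        using fin[of \<sigma>] by (meson finite_Pow_iff finite_subset subset_trans)
      then show "x \<in> ?C \<times> {S. S \<subseteq> ?C \<and> finite S}"
        using fin[of \<sigma>] Fa[of \<sigma>] x by (simp add: mem_Times_iff c_def)
    qed
    have "countable ?C" using countable_Collect_finite_subset[of "range a"] by (simp add: conj_commute)
    moreover have "countable {S. S \<subseteq> ?C \<and> finite S}"
      using countable_Collect_finite_subset[OF calculation] by (simp add: conj_commute)
    ultimately show "countable (?C \<times> {S. S \<subseteq> ?C \<and> finite S})" by blast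
  qed
  ultimately have "countable (UNIV :: nat set set)"
    using countable_image_inj_on by blast
  then show False
    using Cantors_theorem[of "UNIV :: nat set"] range_from_nat_into[of "UNIV :: nat set set"]
    by (metis Pow_UNIV UNIV_not_empty)
qed

section \<open>Ultrafilters and finitely additive measures on an algebra of sets\<close>

definition ultrafilter_on :: "'a set \<Rightarrow> 'a set set \<Rightarrow> 'a set set \<Rightarrow> bool" where
  "ultrafilter_on V A p \<longleftrightarrow> p \<subseteq> A \<and> {} \<notin> p \<and> (\<forall>X\<in>p. \<forall>Y\<in>p. X \<inter> Y \<in> p) \<and>
     (\<forall>X\<in>A. X \<in> p \<or> V - X \<in> p)"

context algebra
begin

lemma ultrafilter_compl_iff:
  assumes "ultrafilter_on \<Omega> M p" "X \<in> M"
  shows "\<Omega> - X \<in> p \<longleftrightarrow> X \<notin> p"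
proof -
  have "X \<inter> (\<Omega> - X) = {}" by blast
  with assms show ?thesis unfolding ultrafilter_on_def by metis
qed

text \<open>Upward closure follows from the other conditions: otherwise the complement of
  \<open>Y\<close> would be a member disjoint from \<open>X\<close>.\<close>

lemma ultrafilter_superset:
  assumes "ultrafilter_on \<Omega> M p" "X \<in> p" "Y \<in> M" "X \<subseteq> Y"
  shows "Y \<in> p"
proof (rule ccontr)
  assume "Y \<notin> p"
  then have "X \<inter> (\<Omega> - Y) \<in> p" using assms unfolding ultrafilter_on_def by blast
  moreover have "X \<inter> (\<Omega> - Y) = {}" using assms by blast
  ultimately show False using assms unfolding ultrafilter_on_def by simp
qed

lemma ultrafilter_space:
  assumes "ultrafilter_on \<Omega> M p"
  shows "\<Omega> \<in> p"
proof -
  have "{} \<notin> p" using assms unfolding ultrafilter_on_def by simp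
  then show ?thesis using ultrafilter_compl_iff[OF assms empty_sets] by simp
qed

lemma ultrafilter_Int_iff:
  assumes "ultrafilter_on \<Omega> M p" "X \<in> M" "Y \<in> M"
  shows "X \<inter> Y \<in> p \<longleftrightarrow> X \<in> p \<and> Y \<in> p"
proof
  assume "X \<inter> Y \<in> p"
  then show "X \<in> p \<and> Y \<in> p"
    using ultrafilter_superset[OF assms(1)] assms(2,3) by (meson inf_le1 inf_le2)
next
  assume "X \<in> p \<and> Y \<in> p"
  then show "X \<inter> Y \<in> p" using assms unfolding ultrafilter_on_def by blast
qed

lemma ultrafilter_Un_iff:
  assumes "ultrafilter_on \<Omega> M p" "X \<in> M" "Y \<in> M"
  shows "X \<union> Y \<in> p \<longleftrightarrow> X \<in> p \<or> Y \<in> p"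
proof -
  have "\<Omega> - (X \<union> Y) = (\<Omega> - X) \<inter> (\<Omega> - Y)" by blast
  then show ?thesis
    using ultrafilter_compl_iff[OF assms(1)] ultrafilter_Int_iff[OF assms(1), of "\<Omega> - X" "\<Omega> - Y"] assms(2,3)
    by (metis Un compl_sets)
qed

text \<open>The intersection with \<open>\<Omega>\<close> gives the empty family the value
  \<open>\<Omega>\<close> instead of \<open>UNIV\<close>.\<close>

lemma ultrafilter_finite_INT:
  assumes "ultrafilter_on \<Omega> M p" "finite I" "\<And>i. i \<in> I \<Longrightarrow> X i \<in> p"
  shows "\<Omega> \<inter> (\<Inter>i\<in>I. X i) \<in> p"
  using assms(2,3)
proof (induction I)
  case empty
  then show ?case using ultrafilter_space[OF assms(1)] by simp
next
  case (insert i I)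
  have "\<Omega> \<inter> (\<Inter>i\<in>insert i I. X i) = X i \<inter> (\<Omega> \<inter> (\<Inter>i\<in>I. X i))" by auto
  with insert assms(1) show ?case unfolding ultrafilter_on_def by simp
qed

text \<open>Distinct ultrafilters are incomparable, so each ordered pair has a set
  \<open>Z p q\<close> in \<open>p\<close> but not in \<open>q\<close>. Cutting \<open>Z p q\<close>
  by the complement of \<open>Z q p\<close>, and intersecting over \<open>q\<close>, yields disjoint
  members.\<close>

lemma ultrafilters_separated:
  assumes "finite F" "\<And>p. p \<in> F \<Longrightarrow> ultrafilter_on \<Omega> M p"
  shows "\<exists>X. (\<forall>p\<in>F. X p \<in> p) \<and> disjoint_family_on X F"
proof -
  have "\<exists>Z. Z \<in> p \<and> Z \<notin> q" if "p \<in> F" "q \<in> F" "p \<noteq> q" for p q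
  proof (rule ccontr)
    assume "\<not> ?thesis"
    then have sub: "p \<subseteq> q" by blast
    have "q \<subseteq> p"
    proof
      fix Z assume Z: "Z \<in> q"
      then have "Z \<in> M" using assms(2)[OF \<open>q \<in> F\<close>] unfolding ultrafilter_on_def by blast
      then show "Z \<in> p"
        using ultrafilter_compl_iff assms(2) that(1,2) sub Z by blast
    qed
    with sub \<open>p \<noteq> q\<close> show False by simp
  qed
  then obtain Z where Z: "\<And>p q. p \<in> F \<Longrightarrow> q \<in> F \<Longrightarrow> p \<noteq> q \<Longrightarrow> Z p q \<in> p \<and> Z p q \<notin> q"
    by metis
  define X where "X p = \<Omega> \<inter> (\<Inter>q\<in>F - {p}. Z p q \<inter> (\<Omega> - Z q p))" for p
  have "X p \<in> p" if p: "p \<in> F" for p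
    unfolding X_def
  proof (rule ultrafilter_finite_INT)
    fix q assume q: "q \<in> F - {p}"
    then have "Z q p \<in> M" using Z[of q p] p assms(2)[of q] unfolding ultrafilter_on_def by blast
    then have "\<Omega> - Z q p \<in> p" using ultrafilter_compl_iff[OF assms(2)[OF p]] Z[of q p] p q by blast
    then show "Z p q \<inter> (\<Omega> - Z q p) \<in> p"
      using assms(2)[OF p] Z[of p q] p q unfolding ultrafilter_on_def by blast
  qed (use assms p in auto)
  moreover have "disjoint_family_on X F"
    unfolding disjoint_family_on_def X_def by blast
  ultimately show ?thesis by blast
qed

end

text \<open>The total measure is left arbitrary, so that the remainder of a measure after
  subtraction of its point masses is again an instance.\<close>

locale finite_content = algebra \<Omega> M for \<Omega> :: "'a set" and M +
  fixes \<mu> :: "'a set \<Rightarrow> real"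
  assumes nonneg: "X \<in> M \<Longrightarrow> 0 \<le> \<mu> X"
    and additive: "additive M \<mu>"
begin

section \<open>Elementary properties of finitely additive contents\<close>

lemma content_Un: "X \<in> M \<Longrightarrow> Y \<in> M \<Longrightarrow> X \<inter> Y = {} \<Longrightarrow> \<mu> (X \<union> Y) = \<mu> X + \<mu> Y"
  using additive by (auto simp: additive_def)

lemma content_empty: "\<mu> {} = 0"
  using content_Un[of "{}" "{}"] by simp

lemma content_split: "X \<in> M \<Longrightarrow> Y \<in> M \<Longrightarrow> \<mu> X = \<mu> (X \<inter> Y) + \<mu> (X - Y)"
  using content_Un[of "X \<inter> Y" "X - Y"] by (metis Diff Diff_disjoint Int Int_Diff Int_Diff_Un Int_Diff_disjoint)

lemma content_mono: "X \<in> M \<Longrightarrow> Y \<in> M \<Longrightarrow> X \<subseteq> Y \<Longrightarrow> \<mu> X \<le> \<mu> Y"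
  using content_split[of Y X] nonneg[of "Y - X"] by (simp add: Diff inf.absorb2)

lemma content_Un_le: "X \<in> M \<Longrightarrow> Y \<in> M \<Longrightarrow> \<mu> (X \<union> Y) \<le> \<mu> X + \<mu> Y"
  using content_Un[of X "Y - X"] content_mono[of "Y - X" Y] by (simp add: Diff)

lemma content_UN:
  "finite I \<Longrightarrow> (\<And>i. i \<in> I \<Longrightarrow> X i \<in> M) \<Longrightarrow> disjoint_family_on X I \<Longrightarrow> \<mu> (\<Union>i\<in>I. X i) = (\<Sum>i\<in>I. \<mu> (X i))"
proof (induction I rule: finite_induct)
  case (insert i I)
  have "X i \<inter> (\<Union>i\<in>I. X i) = {}"
    using insert.hyps(2) disjoint_family_onD[OF insert.prems(2), of i] by fastforce
  moreover have "disjoint_family_on X I"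
    using insert.prems(2) by (rule disjoint_family_on_mono[rotated]) blast
  moreover have "(\<Union>i\<in>I. X i) \<in> M" using insert.hyps(1) insert.prems(1) by (intro finite_UN) auto
  ultimately show ?case using insert content_Un[of "X i" "\<Union>i\<in>I. X i"] by simp
qed (simp add: content_empty)

lemma content_subalgebra:
  assumes "algebra \<Omega> A" "A \<subseteq> M"
  shows "finite_content \<Omega> A \<mu>"
proof -
  interpret A: algebra \<Omega> A by fact
  show ?thesis
    by unfold_locales (use nonneg additive assms(2) in \<open>auto simp: additive_def\<close>)
qed

text \<open>For an ultrafilter \<open>p\<close> this is the weight of the point \<open>p\<close>
  when \<open>\<mu>\<close> is regarded as a measure on the Stone space of \<open>M\<close>.\<close>

definition mass :: "'a set set \<Rightarrow> real" where
  "mass p = Inf (\<mu> ` p)"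

abbreviation ultrafilters :: "'a set set set" where
  "ultrafilters \<equiv> Collect (ultrafilter_on \<Omega> M)"

lemma mass_le: "p \<in> ultrafilters \<Longrightarrow> X \<in> p \<Longrightarrow> mass p \<le> \<mu> X"
  unfolding mass_def ultrafilter_on_def
  by (rule cINF_lower) (auto intro!: bdd_belowI2[where m = 0] nonneg)

lemma mass_greatest: "p \<in> ultrafilters \<Longrightarrow> (\<And>X. X \<in> p \<Longrightarrow> m \<le> \<mu> X) \<Longrightarrow> m \<le> mass p"
  unfolding mass_def by (rule cINF_greatest) (use ultrafilter_space in auto)

lemma mass_nonneg: "p \<in> ultrafilters \<Longrightarrow> 0 \<le> mass p"
  by (rule mass_greatest) (auto simp: ultrafilter_on_def intro: nonneg)

text \<open>Disjoint members of the ultrafilters, cut down to \<open>Z\<close>, each have measure at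
  least the corresponding mass.\<close>

lemma sum_mass_le:
  assumes "finite F" "F \<subseteq> {p \<in> ultrafilters. Z \<in> p}" "Z \<in> M"
  shows "sum mass F \<le> \<mu> Z"
proof -
  obtain X where X: "\<forall>p\<in>F. X p \<in> p" "disjoint_family_on X F"
    using ultrafilters_separated[OF assms(1)] assms(2) by auto
  have XZ: "X p \<inter> Z \<in> p" "X p \<inter> Z \<in> M" if "p \<in> F" for p
    using X(1) assms(2) that unfolding ultrafilter_on_def by blast+
  have "sum mass F \<le> (\<Sum>p\<in>F. \<mu> (X p \<inter> Z))"
    by (rule sum_mono) (use XZ mass_le assms(2) in blast)
  also have "\<dots> = \<mu> (\<Union>p\<in>F. X p \<inter> Z)"
  proof (rule content_UN[symmetric])
    show "disjoint_family_on (\<lambda>p. X p \<inter> Z) F"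
      using X(2) unfolding disjoint_family_on_def by blast
  qed (use assms(1) XZ(2) in auto)
  also have "\<dots> \<le> \<mu> Z"
    by (rule content_mono) (use assms(1,3) XZ(2) in \<open>blast+\<close>)
  finally show ?thesis .
qed

lemma mass_summable: "Z \<in> M \<Longrightarrow> mass summable_on {p \<in> ultrafilters. Z \<in> p}"
  by (rule nonneg_bdd_above_summable_on)
    (auto simp: bdd_above_def mass_nonneg intro!: exI[of _ "\<mu> Z"] sum_mass_le)

lemma infsum_mass_le: "Z \<in> M \<Longrightarrow> infsum mass {p \<in> ultrafilters. Z \<in> p} \<le> \<mu> Z"
  by (rule infsum_le_finite_sums[OF mass_summable]) (auto intro: sum_mass_le)

text \<open>An atom of the part of \<open>\<mu>\<close> not carried by ultrafilters of positive mass would itself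
  define an ultrafilter, whose mass it would increase.\<close>

lemma infsum_mass_eq:
  assumes atom: "\<And>\<rho>. finite_content \<Omega> M \<rho> \<Longrightarrow> 0 < \<rho> \<Omega> \<Longrightarrow>
      \<exists>X\<in>M. 0 < \<rho> X \<and> (\<forall>Z\<in>M. \<rho> (X \<inter> Z) = 0 \<or> \<rho> (X - Z) = 0)"
  shows "infsum mass ultrafilters = \<mu> \<Omega>"
proof (rule ccontr)
  assume neq: "infsum mass ultrafilters \<noteq> \<mu> \<Omega>"
  have top_all: "{p \<in> ultrafilters. \<Omega> \<in> p} = ultrafilters" using ultrafilter_space by blast
  \<comment> \<open>What the masses leave of \<open>\<mu>\<close>; it is nonnegative by
    \<open>infsum_mass_le\<close>.\<close>
  define \<rho> where "\<rho> Z = \<mu> Z - infsum mass {p \<in> ultrafilters. Z \<in> p}" for Z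
  have "additive M \<rho>"
    unfolding additive_def
  proof (intro ballI impI)
    fix X Y assume XY: "X \<in> M" "Y \<in> M" "X \<inter> Y = {}"
    \<comment> \<open>Additivity of \<open>\<rho>\<close> rests on primality: an ultrafilter
      containing a disjoint union contains exactly one of the two parts.\<close>
    have "{p \<in> ultrafilters. X \<union> Y \<in> p} = {p \<in> ultrafilters. X \<in> p} \<union> {p \<in> ultrafilters. Y \<in> p}"
      using ultrafilter_Un_iff XY by blast
    moreover have "{p \<in> ultrafilters. X \<in> p} \<inter> {p \<in> ultrafilters. Y \<in> p} = {}"
      using XY(3) by (auto simp: ultrafilter_on_def) metis
    ultimately show "\<rho> (X \<union> Y) = \<rho> X + \<rho> Y"
      using infsum_Un_disjoint[OF mass_summable mass_summable, OF XY(1,2)] content_Un[OF XY]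
      by (simp add: \<rho>_def)
  qed
  then interpret L: finite_content \<Omega> M \<rho>
    by unfold_locales (use infsum_mass_le in \<open>auto simp: \<rho>_def\<close>)
  have "0 < \<rho> \<Omega>" using neq infsum_mass_le[OF top] unfolding \<rho>_def top_all by simp
  then obtain X where X: "X \<in> M" "0 < \<rho> X" "\<forall>Z\<in>M. \<rho> (X \<inter> Z) = 0 \<or> \<rho> (X - Z) = 0"
    using atom L.finite_content_axioms by blast
  \<comment> \<open>The sets that contain the atom \<open>X\<close> up to a
    \<open>\<rho>\<close>-null set.\<close>
  define p where "p = {Z \<in> M. \<rho> (X - Z) = 0}"
  have p: "ultrafilter_on \<Omega> M p"
    unfolding ultrafilter_on_def
  proof (intro conjI ballI)
    show "{} \<notin> p" using X(2) by (simp add: p_def)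
  next
    fix Y Z assume YZ: "Y \<in> p" "Z \<in> p"
    have "\<rho> ((X - Y) \<union> (X - Z)) \<le> 0"
      using L.content_Un_le[of "X - Y" "X - Z"] YZ X(1) by (simp add: p_def Diff)
    then show "Y \<inter> Z \<in> p"
      using YZ X(1) L.nonneg[of "X - Y \<inter> Z"] by (simp add: p_def Diff_Int Int Diff Un)
  next
    fix Y assume Y: "Y \<in> M"
    have "X - (\<Omega> - Y) = X \<inter> Y" using X(1) sets_into_space by blast
    then show "Y \<in> p \<or> \<Omega> - Y \<in> p" using X(3) Y by (auto simp: p_def)
  qed (simp add: p_def)
  have "\<rho> X + mass p \<le> \<mu> Z" if Z: "Z \<in> p" for Z
  proof -
    have ZM: "Z \<in> M" and "\<rho> (X - Z) = 0" using Z by (auto simp: p_def)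
    then have "\<rho> X \<le> \<rho> Z"
      using L.content_split[of X Z] L.content_mono[of "X \<inter> Z" Z] X(1) by (simp add: Int)
    \<comment> \<open>The ultrafilter \<open>p\<close> is itself among those whose masses were
      subtracted, so \<open>\<mu> Z\<close> exceeds \<open>\<rho> Z\<close> by at least
      \<open>mass p\<close>.\<close>
    moreover have "mass p \<le> infsum mass {p \<in> ultrafilters. Z \<in> p}"
      using finite_sum_le_infsum[OF mass_summable[OF ZM], of "{p}"] p Z mass_nonneg by simp
    ultimately show ?thesis by (simp add: \<rho>_def)
  qed
  then have "\<rho> X + mass p \<le> mass p" using mass_greatest p by blast
  with X(2) show False by simp
qed

text \<open>The masses add up to \<open>\<mu> \<Omega>\<close>, so finitely many ultrafilters carry
  nearly everything. Each gets a piece whose measure is at most \<open>1 + \<epsilon>\<close> times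
  its mass; since every member of the ultrafilter takes up at least the mass, little of the piece
  lies outside that member.\<close>

lemma ultrafilter_partition:
  assumes atom: "\<And>\<rho>. finite_content \<Omega> M \<rho> \<Longrightarrow> 0 < \<rho> \<Omega> \<Longrightarrow>
      \<exists>X\<in>M. 0 < \<rho> X \<and> (\<forall>Z\<in>M. \<rho> (X \<inter> Z) = 0 \<or> \<rho> (X - Z) = 0)"
    and pos: "0 < \<mu> \<Omega>" and "0 < \<epsilon>"
  shows "\<exists>P. finite P \<and> partition_on \<Omega> P \<and> (\<forall>X\<in>P. X \<in> M \<and> 0 < \<mu> X \<and>
      (\<exists>p. ultrafilter_on \<Omega> M p \<and> X \<in> p \<and> (\<forall>Z\<in>p. \<mu> (X - Z) \<le> \<epsilon> * \<mu> X)))"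
proof -
  have top_all: "{p \<in> ultrafilters. \<Omega> \<in> p} = ultrafilters" using ultrafilter_space by blast
  have sums: "(mass has_sum \<mu> \<Omega>) ultrafilters"
    using infsum_mass_eq[OF atom] mass_summable[OF top] unfolding top_all
    by (metis has_sum_infsum)
  have approx: "\<exists>F. finite F \<and> F \<subseteq> ultrafilters \<and> \<mu> \<Omega> - \<delta> < sum mass F" if "0 < \<delta>" for \<delta>
  proof (rule ccontr)
    assume "\<not> ?thesis"
    then have "infsum mass ultrafilters \<le> \<mu> \<Omega> - \<delta>"
      using infsum_le_finite_sums[of mass ultrafilters] sums by (meson has_sum_imp_summable not_le)
    then show False using infsumI[OF sums] that by simp
  qed
  obtain F\<^sub>0 where F0: "finite F\<^sub>0" "F\<^sub>0 \<subseteq> ultrafilters" "0 < sum mass F\<^sub>0"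
    using approx[OF pos] by auto
  \<comment> \<open>\<open>q\<close> is fixed before the tolerance \<open>\<delta>\<close>: the
    remainder will join the piece of \<open>q\<close>, so it must be small compared with
    \<open>mass q\<close>.\<close>
  then obtain q where q: "q \<in> ultrafilters" "0 < mass q"
    by (metis less_irrefl subsetD sum.neutral mass_nonneg order_le_less)
  define \<delta> where "\<delta> = \<epsilon> / 2 * mass q"
  obtain F\<^sub>1 where F1: "finite F\<^sub>1" "F\<^sub>1 \<subseteq> ultrafilters" "\<mu> \<Omega> - \<delta> < sum mass F\<^sub>1"
    using approx[of \<delta>] q \<open>0 < \<epsilon>\<close> by (auto simp: \<delta>_def)
  \<comment> \<open>Discarding ultrafilters of mass zero keeps the sum and makes every piece have
    positive measure.\<close>
  define F where "F = {p \<in> insert q F\<^sub>1. 0 < mass p}"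
  have F: "finite F" "q \<in> F" and Fu: "\<And>p. p \<in> F \<Longrightarrow> p \<in> ultrafilters" and Fpos: "\<And>p. p \<in> F \<Longrightarrow> 0 < mass p"
    using F1 q by (auto simp: F_def)
  have "sum mass F\<^sub>1 \<le> sum mass (insert q F\<^sub>1)"
    by (rule sum_mono2) (use F1 q in auto)
  also have "\<dots> = sum mass F"
    by (rule sum.mono_neutral_right) (use F1 q mass_nonneg in \<open>auto simp: F_def less_le\<close>)
  finally have F_large: "\<mu> \<Omega> - \<delta> < sum mass F" using F1(3) by simp
  obtain Y where Y: "\<forall>p\<in>F. Y p \<in> p" "disjoint_family_on Y F"
    using ultrafilters_separated[OF F(1)] Fu by blast
  \<comment> \<open>Half of the allowed excess is spent here; the other half is kept for the
    remainder.\<close>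
  have "\<exists>Z\<in>p. \<mu> Z < (1 + \<epsilon> / 2) * mass p" if p: "p \<in> F" for p
  proof (rule ccontr)
    assume "\<not> ?thesis"
    then have "(1 + \<epsilon> / 2) * mass p \<le> mass p"
      using mass_greatest[OF Fu[OF p]] by (meson not_le)
    moreover have "0 < \<epsilon> / 2 * mass p" using Fpos[OF p] \<open>0 < \<epsilon>\<close> by simp
    ultimately show False by (simp add: algebra_simps)
  qed
  then obtain Z where Z: "\<And>p. p \<in> F \<Longrightarrow> Z p \<in> p \<and> \<mu> (Z p) < (1 + \<epsilon> / 2) * mass p" by metis
  define X where "X p = Y p \<inter> Z p" for p
  have Xp: "X p \<in> p" and XM: "X p \<in> M" if "p \<in> F" for p
    using Y(1) Z[OF that] Fu[OF that] that by (auto simp: X_def ultrafilter_on_def)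
  have X_disj: "disjoint_family_on X F"
    using Y(2) unfolding X_def disjoint_family_on_def by blast
  have X_small: "\<mu> (X p) \<le> (1 + \<epsilon> / 2) * mass p" if "p \<in> F" for p
  proof -
    have "Z p \<in> M" using Z[OF that] Fu[OF that] by (auto simp: ultrafilter_on_def)
    then have "\<mu> (X p) \<le> \<mu> (Z p)" using XM[OF that] content_mono by (simp add: X_def)
    then show ?thesis using Z[OF that] by simp
  qed
  define U where "U = \<Omega> - (\<Union>p\<in>F. X p)"
  have UN_M: "(\<Union>p\<in>F. X p) \<in> M" using F(1) XM by blast
  then have U: "U \<in> M" by (simp add: U_def compl_sets)
  have "sum mass F \<le> (\<Sum>p\<in>F. \<mu> (X p))"
    by (rule sum_mono) (use mass_le Fu Xp in blast)
  also have "\<dots> = \<mu> (\<Union>p\<in>F. X p)"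
    by (rule content_UN[symmetric]) (use F(1) XM X_disj in auto)
  finally have U_small: "\<mu> U \<le> \<delta>"
    using content_split[OF top UN_M] F_large UN_M sets_into_space by (simp add: U_def inf.absorb2)
  define X' where "X' p = (if p = q then X q \<union> U else X p)" for p
  have X'M: "X' p \<in> M" if "p \<in> F" for p using that XM U F(2) by (simp add: X'_def Un)
  have X'p: "X' p \<in> p" if "p \<in> F" for p
    using ultrafilter_superset[of p, OF _ Xp X'M] Fu that by (auto simp: X'_def)
  have X'_small: "\<mu> (X' p) \<le> (1 + \<epsilon>) * mass p" if "p \<in> F" for p
  proof (cases "p = q")
    case True
    have "\<mu> (X' q) \<le> \<mu> (X q) + \<mu> U" using content_Un_le XM U F(2) by (simp add: X'_def)
    also have "\<dots> \<le> (1 + \<epsilon>) * mass q" using X_small[OF F(2)] U_small by (simp add: \<delta>_def algebra_simps)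
    finally show ?thesis using True by simp
  next
    case False
    have "(1 + \<epsilon> / 2) * mass p \<le> (1 + \<epsilon>) * mass p"
      using \<open>0 < \<epsilon>\<close> Fpos[OF that] by (intro mult_right_mono) auto
    with False X_small[OF that] show ?thesis by (simp add: X'_def)
  qed
  have X'_pos: "mass p \<le> \<mu> (X' p)" if "p \<in> F" for p
    using mass_le Fu X'p that by blast
  have X'_disj: "X' p \<inter> X' r = {}" if "p \<in> F" "r \<in> F" "p \<noteq> r" for p r
  proof -
    have "X p \<inter> X r = {}" "X p \<inter> U = {}" "X r \<inter> U = {}"
      using X_disj that unfolding disjoint_family_on_def U_def by blast+
    then show ?thesis using that(3) by (auto simp: X'_def)
  qed
  have "partition_on \<Omega> (X' ` F)"
  proof (rule partition_onI)
    have "(\<Union>p\<in>F. X' p) = (\<Union>p\<in>F. X p) \<union> U" using F(2) by (auto simp: X'_def)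
    also have "\<dots> = \<Omega>" using sets_into_space[OF UN_M] unfolding U_def by blast
    finally show "(\<Union>p\<in>F. X' p) = \<Omega>" .
  next
    fix A B assume "A \<in> X' ` F" "B \<in> X' ` F" "A \<noteq> B"
    then show "disjnt A B" using X'_disj unfolding disjnt_def by (elim imageE) auto
  next
    show "{} \<notin> X' ` F"
    proof
      assume "{} \<in> X' ` F"
      then obtain p where "p \<in> F" "X' p = {}" by auto
      with X'p[of p] Fu[of p] show False by (simp add: ultrafilter_on_def)
    qed
  qed
  \<comment> \<open>\<open>X' p\<close> has measure at most \<open>1 + \<epsilon>\<close> times
    \<open>mass p\<close>, and its part inside \<open>A\<close> has at least
    \<open>mass p\<close>.\<close>
  moreover have "\<mu> (X' p - A) \<le> \<epsilon> * \<mu> (X' p)" if p: "p \<in> F" and A: "A \<in> p" for p A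
  proof -
    have AM: "A \<in> M" and "X' p \<inter> A \<in> p"
      using A Fu[OF p] X'p[OF p] by (auto simp: ultrafilter_on_def)
    then have "mass p \<le> \<mu> (X' p \<inter> A)" using mass_le Fu[OF p] by blast
    then have "\<mu> (X' p - A) \<le> \<epsilon> * mass p"
      using content_split[OF X'M[OF p] AM] X'_small[OF p] by (simp add: algebra_simps)
    also have "\<dots> \<le> \<epsilon> * \<mu> (X' p)" using X'_pos[OF p] \<open>0 < \<epsilon>\<close> by simp
    finally show ?thesis .
  qed
  moreover have "0 < \<mu> (X' p)" if "p \<in> F" for p
    using X'_pos[OF that] Fpos[OF that] by simp
  moreover have "ultrafilter_on \<Omega> M p" if "p \<in> F" for p
    using Fu[OF that] by simp
  ultimately have "\<forall>X\<in>X' ` F. X \<in> M \<and> 0 < \<mu> X \<and>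
      (\<exists>p. ultrafilter_on \<Omega> M p \<and> X \<in> p \<and> (\<forall>Z\<in>p. \<mu> (X - Z) \<le> \<epsilon> * \<mu> X))"
    using X'M X'p by blast
  with \<open>partition_on \<Omega> (X' ` F)\<close> F(1) show ?thesis by blast
qed

end

section \<open>Definability of types and symmetry\<close>

lemma algebra_boolean_combinations:
  assumes "G \<subseteq> Pow U" "G \<noteq> {}"
  shows "algebra U (boolean_combinations U G)"
  unfolding algebra_iff_Un
proof (intro conjI ballI)
  have "X \<subseteq> U" if "X \<in> boolean_combinations U G" for X
    using that assms(1) by induction auto
  then show "boolean_combinations U G \<subseteq> Pow U" by blast
  \<comment> \<open>The inductive definition has no clause for the empty set, which arises from a
    generator and its complement.\<close>
  obtain X where "X \<in> boolean_combinations U G"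
    using assms(2) by (auto intro: boolean_combinations.gen)
  then have "X \<inter> (U - X) \<in> boolean_combinations U G"
    by (intro boolean_combinations.inter boolean_combinations.compl)
  then show "{} \<in> boolean_combinations U G" by simp
qed (auto intro: boolean_combinations.intros)

lemma boolean_combinations_mono:
  assumes "G \<subseteq> H"
  shows "boolean_combinations U G \<subseteq> boolean_combinations U H"
proof
  fix X assume "X \<in> boolean_combinations U G"
  then show "X \<in> boolean_combinations U H"
    by induction (use assms in \<open>auto intro: boolean_combinations.intros\<close>)
qed

lemma boolean_combinations_least:
  assumes "algebra U A" "G \<subseteq> A"
  shows "boolean_combinations U G \<subseteq> A"
proof
  interpret algebra U A by fact
  fix X assume "X \<in> boolean_combinations U G"
  then show "X \<in> A" by induction (use assms in auto)
qed

text \<open>Ultrafilters on this algebra are the complete \<open>R\<close>-types in the first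
  variable over \<open>W\<close>.\<close>

definition fiber_algebra :: "'a set \<Rightarrow> 'b set \<Rightarrow> ('a \<times> 'b) set \<Rightarrow> 'a set set" where
  "fiber_algebra V W R = boolean_combinations V (fiber V R ` W)"

lemma algebra_fiber_algebra: "W \<noteq> {} \<Longrightarrow> algebra V (fiber_algebra V W R)"
  unfolding fiber_algebra_def by (rule algebra_boolean_combinations) (auto simp: fiber_def)

lemma fiber_in_fiber_algebra: "b \<in> W \<Longrightarrow> fiber V R b \<in> fiber_algebra V W R"
  unfolding fiber_algebra_def by (rule boolean_combinations.gen) simp

text \<open>In model-theoretic terms, the \<open>R\<close>-definition of the type
  \<open>p\<close>.\<close>

definition defining_set :: "'a set \<Rightarrow> 'b set \<Rightarrow> ('a \<times> 'b) set \<Rightarrow> 'a set set \<Rightarrow> 'b set" where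
  "defining_set V W R p = {b \<in> W. fiber V R b \<in> p}"

text \<open>The finitely many conditions that \<open>p\<close> imposes over \<open>B\<close>
  intersect with \<open>X\<close> in a member of \<open>p\<close>, which is nonempty.\<close>

lemma ultrafilter_realize:
  assumes "W \<noteq> {}" and p: "ultrafilter_on V (fiber_algebra V W R) p"
    and B: "finite B" "B \<subseteq> W" and "X \<in> p"
  shows "\<exists>a\<in>X. a \<in> V \<and> (\<forall>b\<in>B. (a, b) \<in> R \<longleftrightarrow> b \<in> defining_set V W R p)"
proof -
  interpret algebra V "fiber_algebra V W R" using assms(1) by (rule algebra_fiber_algebra)
  define Y where "Y b = (if fiber V R b \<in> p then fiber V R b else V - fiber V R b)" for b
  have "V \<inter> (\<Inter>b\<in>B. Y b) \<in> p"
  proof (rule ultrafilter_finite_INT[OF p B(1)])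
    fix b assume "b \<in> B"
    then have "fiber V R b \<in> fiber_algebra V W R" using B(2) by (intro fiber_in_fiber_algebra) auto
    then show "Y b \<in> p" using ultrafilter_compl_iff[OF p] by (simp add: Y_def)
  qed
  then have "X \<inter> (V \<inter> (\<Inter>b\<in>B. Y b)) \<in> p" "{} \<notin> p"
    using p \<open>X \<in> p\<close> by (simp_all add: ultrafilter_on_def)
  then have "X \<inter> (V \<inter> (\<Inter>b\<in>B. Y b)) \<noteq> {}" by metis
  then obtain a where a: "a \<in> X" "a \<in> V" "\<And>b. b \<in> B \<Longrightarrow> a \<in> Y b" by blast
  have "(a, b) \<in> R \<longleftrightarrow> b \<in> defining_set V W R p" if "b \<in> B" for b
    using a(2) a(3)[OF that] B(2) that
    by (auto simp: Y_def fiber_def defining_set_def split: if_splits)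
  with a show ?thesis by blast
qed

text \<open>By \<open>stable_rel_trace_determines\<close> membership in the defining set depends
  only on the trace on a finite set of points of \<open>V\<close>, and finitely many traces
  occur.\<close>

lemma defining_set_in_fiber_algebra:
  assumes st: "stable_rel V W R" and ne: "V \<noteq> {}" "W \<noteq> {}"
    and p: "ultrafilter_on V (fiber_algebra V W R) p"
  shows "defining_set V W R p \<in> fiber_algebra W V (R\<inverse>)"
proof -
  interpret V: algebra V "fiber_algebra V W R" using ne(2) by (rule algebra_fiber_algebra)
  interpret W: algebra W "fiber_algebra W V (R\<inverse>)" using ne(1) by (rule algebra_fiber_algebra)
  let ?D = "defining_set V W R p"
  have "\<exists>a\<in>V. \<forall>b\<in>B. (a, b) \<in> R \<longleftrightarrow> b \<in> ?D" if "finite B" "B \<subseteq> W" for B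
    using ultrafilter_realize[OF ne(2) p that V.ultrafilter_space[OF p]] by blast
  from stable_rel_trace_determines[OF st this]
  obtain F where F: "finite F" "F \<subseteq> V"
    "\<And>b c. b \<in> W \<Longrightarrow> c \<in> W \<Longrightarrow> b \<in> ?D \<Longrightarrow> {a \<in> F. (a, b) \<in> R} \<subseteq> {a \<in> F. (a, c) \<in> R} \<Longrightarrow> c \<in> ?D"
    by blast
  define T where "T = (\<lambda>b. {a \<in> F. (a, b) \<in> R}) ` ?D"
  have "T \<subseteq> Pow F" by (auto simp: T_def)
  then have T: "finite T" using F(1) by (meson finite_Pow_iff finite_subset)
  have DW: "?D \<subseteq> W" by (auto simp: defining_set_def)
  have "?D = {c \<in> W. \<exists>S\<in>T. \<forall>a\<in>F. (a, c) \<in> R \<longleftrightarrow> a \<in> S}"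
  proof (intro subset_antisym subsetI)
    fix c assume "c \<in> {c \<in> W. \<exists>S\<in>T. \<forall>a\<in>F. (a, c) \<in> R \<longleftrightarrow> a \<in> S}"
    then obtain b where "c \<in> W" "b \<in> ?D" "\<forall>a\<in>F. (a, c) \<in> R \<longleftrightarrow> (a, b) \<in> R"
      by (auto simp: T_def)
    then show "c \<in> ?D" using F(3)[of b c] DW by auto
  next
    fix c assume "c \<in> ?D"
    then show "c \<in> {c \<in> W. \<exists>S\<in>T. \<forall>a\<in>F. (a, c) \<in> R \<longleftrightarrow> a \<in> S}" using DW by (auto simp: T_def)
  qed
  also have "\<dots> \<in> fiber_algebra W V (R\<inverse>)"
  proof (intro W.sets_Collect_finite_Ex W.sets_Collect_finite_All T F(1))
    fix a S assume "a \<in> F"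
    then have *: "fiber W (R\<inverse>) a \<in> fiber_algebra W V (R\<inverse>)" using F(2) by (intro fiber_in_fiber_algebra) auto
    show "{c \<in> W. (a, c) \<in> R \<longleftrightarrow> a \<in> S} \<in> fiber_algebra W V (R\<inverse>)"
    proof (cases "a \<in> S")
      case True
      then have "{c \<in> W. (a, c) \<in> R \<longleftrightarrow> a \<in> S} = fiber W (R\<inverse>) a" by (auto simp: fiber_def)
      with * show ?thesis by simp
    next
      case False
      then have "{c \<in> W. (a, c) \<in> R \<longleftrightarrow> a \<in> S} = W - fiber W (R\<inverse>) a" by (auto simp: fiber_def)
      with * show ?thesis by (simp add: W.compl_sets)
    qed
  qed
  finally show ?thesis .
qed

text \<open>If the conclusion failed, realising alternately \<open>p\<close> and \<open>q\<close> over the elements found so far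
  would produce a ladder.\<close>

lemma defining_set_symmetric:
  assumes st: "stable_rel V W R" and ne: "V \<noteq> {}" "W \<noteq> {}"
    and p: "ultrafilter_on V (fiber_algebra V W R) p"
    and q: "ultrafilter_on W (fiber_algebra W V (R\<inverse>)) q"
    and qp: "defining_set W V (R\<inverse>) q \<in> p"
  shows "defining_set V W R p \<in> q"
proof (rule ccontr)
  interpret W: algebra W "fiber_algebra W V (R\<inverse>)" using ne(1) by (rule algebra_fiber_algebra)
  let ?D = "defining_set V W R p" and ?E = "defining_set W V (R\<inverse>) q"
  assume "?D \<notin> q"
  then have Dq: "W - ?D \<in> q"
    using W.ultrafilter_compl_iff[OF q defining_set_in_fiber_algebra[OF st ne p]] by simp
  \<comment> \<open>Each new \<open>a\<close> realises \<open>p\<close> inside \<open>?E\<close>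
    over the earlier \<open>b\<close>, which avoid \<open>?D\<close>, so it is unrelated to them.
    Each new \<open>b\<close> realises \<open>q\<close> outside \<open>?D\<close> over all
    \<open>a\<close> so far, which lie in \<open>?E\<close>, so it is related to them.\<close>
  define ok where "ok f n r \<longleftrightarrow> (case r of (a, b) \<Rightarrow> a \<in> V \<and> a \<in> ?E \<and> b \<in> W \<and> b \<notin> ?D \<and> (a, b) \<in> R
      \<and> (\<forall>i<n. (a, snd (f i)) \<notin> R \<and> (fst (f i), b) \<in> R))" for f :: "nat \<Rightarrow> 'a \<times> 'b" and n r
  have "\<exists>f. \<forall>n. ok f n (f n)"
  proof (rule dependent_wf_choice[OF wf_less_than])
    fix f g :: "nat \<Rightarrow> 'a \<times> 'b" and n r
    assume "\<And>z. (z, n) \<in> less_than \<Longrightarrow> f z = g z"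
    then have "f i = g i" if "i < n" for i using that by simp
    then show "ok f n r = ok g n r" unfolding ok_def by (intro prod.case_cong refl) (metis (no_types, lifting))
  next
    fix n and f :: "nat \<Rightarrow> 'a \<times> 'b"
    assume ok: "\<And>y. (y, n) \<in> less_than \<Longrightarrow> ok f y (f y)"
    have IH: "fst (f i) \<in> V \<and> fst (f i) \<in> ?E \<and> snd (f i) \<in> W \<and> snd (f i) \<notin> ?D" if "i < n" for i
      using ok[of i] that by (cases "f i") (simp add: ok_def)
    obtain a where a: "a \<in> ?E" "a \<in> V" "\<forall>b\<in>(\<lambda>i. snd (f i)) ` {..<n}. (a, b) \<in> R \<longleftrightarrow> b \<in> ?D"
      using ultrafilter_realize[OF ne(2) p _ _ qp, of "(\<lambda>i. snd (f i)) ` {..<n}"] IH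
      by (auto simp: image_subset_iff)
    obtain b where b: "b \<in> W - ?D"
        "\<forall>a\<in>insert a ((\<lambda>i. fst (f i)) ` {..<n}). (b, a) \<in> R\<inverse> \<longleftrightarrow> a \<in> ?E"
      using ultrafilter_realize[OF ne(1) q _ _ Dq, of "insert a ((\<lambda>i. fst (f i)) ` {..<n})"] IH a(2)
      by (auto simp: image_subset_iff)
    have "ok f n (a, b)" using a b IH by (simp add: ok_def)
    then show "\<exists>r. ok f n r" ..
  qed
  then obtain f where f: "\<And>n. ok f n (f n)" by blast
  have in_VW: "fst (f i) \<in> V" "snd (f i) \<in> W" for i
    using f[of i] by (auto simp: ok_def split: prod.splits)
  have "(fst (f i), snd (f j)) \<in> R \<longleftrightarrow> i \<le> j" for i j
    using f[of i] f[of j] by (cases i j rule: linorder_cases) (auto simp: ok_def split: prod.splits)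
  then show False by (rule stable_rel_no_ladder[OF st, rotated 2]) (auto simp: in_VW)
qed

text \<open>Applied to the sets of positive content, \<open>stable_rel_unsplit\<close> gives a set
  \<open>X\<close> that no fibre divides into two positive parts. The sets that fail to divide
  \<open>X\<close> are closed under Boolean operations, hence exhaust the algebra.\<close>

lemma stable_rel_atom:
  assumes st: "stable_rel V W R" and "W \<noteq> {}"
    and "finite_content V (fiber_algebra V W R) \<rho>" and pos: "0 < \<rho> V"
  shows "\<exists>X\<in>fiber_algebra V W R. 0 < \<rho> X \<and>
    (\<forall>Z\<in>fiber_algebra V W R. \<rho> (X \<inter> Z) = 0 \<or> \<rho> (X - Z) = 0)"
proof -
  let ?A = "fiber_algebra V W R"
  interpret finite_content V ?A \<rho> by fact
  have "\<exists>X\<in>{X \<in> ?A. 0 < \<rho> X}. \<forall>b\<in>W. X \<inter> fiber V R b \<notin> {X \<in> ?A. 0 < \<rho> X} \<or> X - fiber V R b \<notin> {X \<in> ?A. 0 < \<rho> X}"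
  proof (rule stable_rel_unsplit[OF st])
    show "{X \<in> ?A. 0 < \<rho> X} \<subseteq> Pow V" using sets_into_space by blast
    show "{} \<notin> {X \<in> ?A. 0 < \<rho> X}" by (simp add: content_empty)
    show "V \<in> {X \<in> ?A. 0 < \<rho> X}" using pos by simp
  qed
  then obtain X where X: "X \<in> ?A" "0 < \<rho> X"
    "\<And>b. b \<in> W \<Longrightarrow> X \<inter> fiber V R b \<notin> {X \<in> ?A. 0 < \<rho> X} \<or> X - fiber V R b \<notin> {X \<in> ?A. 0 < \<rho> X}"
    by blast
  have null: "\<rho> Y = 0" if "Y \<in> ?A" "Z \<in> ?A" "Y \<subseteq> Z" "\<rho> Z = 0" for Y Z
    using content_mono[OF that(1-3)] nonneg[OF that(1)] that(4) by simp
  have null_Un: "\<rho> (Y \<union> Z) = 0" if "Y \<in> ?A" "Z \<in> ?A" "\<rho> Y = 0" "\<rho> Z = 0" for Y Z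
    using content_Un_le[OF that(1,2)] nonneg[OF Un[OF that(1,2)]] that(3,4) by simp
  have "Z \<in> ?A \<and> (\<rho> (X \<inter> Z) = 0 \<or> \<rho> (X - Z) = 0)" if "Z \<in> boolean_combinations V (fiber V R ` W)" for Z
    using that
  proof induction
    case (gen Z)
    then obtain b where b: "b \<in> W" "Z = fiber V R b" by blast
    have Z: "Z \<in> ?A" using b fiber_in_fiber_algebra by simp
    have "X \<inter> Z \<in> ?A" "X - Z \<in> ?A" using Z X(1) by auto
    with X(3)[OF b(1)] nonneg[of "X \<inter> Z"] nonneg[of "X - Z"] Z b(2) show ?case by force
  next
    case (compl Z)
    have "X \<inter> (V - Z) = X - Z" "X - (V - Z) = X \<inter> Z" using X(1) sets_into_space by auto
    with compl show ?case by (auto simp: compl_sets)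
  next
    case (inter Y Z)
    have "X - Y \<inter> Z = (X - Y) \<union> (X - Z)" by blast
    moreover have "\<rho> (X \<inter> (Y \<inter> Z)) = 0" if "\<rho> (X \<inter> Y) = 0 \<or> \<rho> (X \<inter> Z) = 0"
      using that inter X(1) null[of "X \<inter> (Y \<inter> Z)" "X \<inter> Y"] null[of "X \<inter> (Y \<inter> Z)" "X \<inter> Z"] by auto
    ultimately show ?case using inter X(1) null_Un[of "X - Y" "X - Z"] by auto
  next
    case (union Y Z)
    have "X \<inter> (Y \<union> Z) = (X \<inter> Y) \<union> (X \<inter> Z)" by blast
    moreover have "\<rho> (X - (Y \<union> Z)) = 0" if "\<rho> (X - Y) = 0 \<or> \<rho> (X - Z) = 0"
      using that union X(1) null[of "X - (Y \<union> Z)" "X - Y"] null[of "X - (Y \<union> Z)" "X - Z"] by auto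
    ultimately show ?case using union X(1) null_Un[of "X \<inter> Y" "X \<inter> Z"] by auto
  qed
  with X show ?thesis unfolding fiber_algebra_def by blast
qed

section \<open>Regularity for finitely additive measures\<close>

lemma almost_all_mono:
  assumes "almost_all D \<mu> \<epsilon> X P" "\<epsilon> \<le> \<delta>" "0 \<le> \<mu> X" "\<And>a. a \<in> X \<Longrightarrow> P a \<Longrightarrow> Q a"
  shows "almost_all D \<mu> \<delta> X Q"
proof -
  obtain E where "E \<in> D" "\<mu> E \<le> \<epsilon> * \<mu> X" "\<forall>a\<in>X - E. P a"
    using assms(1) unfolding almost_all_def by blast
  moreover have "\<epsilon> * \<mu> X \<le> \<delta> * \<mu> X" using assms(2,3) by (rule mult_right_mono)
  ultimately have "E \<in> D \<and> \<mu> E \<le> \<delta> * \<mu> X \<and> (\<forall>a\<in>X - E. Q a)" using assms(4) by simp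
  then show ?thesis unfolding almost_all_def by blast
qed

lemma almost_all_pairs_mono:
  assumes "almost_all_pairs D \<mu> D' \<nu> \<epsilon> X Y P" "\<epsilon> \<le> \<delta>" "0 \<le> \<mu> X" "0 \<le> \<nu> Y"
  shows "almost_all_pairs D \<mu> D' \<nu> \<delta> X Y P"
proof -
  have "almost_all D' \<nu> \<delta> Y (P a)" if "almost_all D' \<nu> \<epsilon> Y (P a)" for a
    using almost_all_mono[OF that assms(2,4)] .
  moreover have "almost_all D \<mu> \<delta> X (\<lambda>a. P a b)" if "almost_all D \<mu> \<epsilon> X (\<lambda>a. P a b)" for b
    using almost_all_mono[OF that assms(2,3)] .
  ultimately show ?thesis
    using assms unfolding almost_all_pairs_def by (blast intro: almost_all_mono)
qed

text \<open>The two exceptional sets together have measure below \<open>\<mu> X\<close>, so they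
  cannot cover \<open>X\<close>.\<close>

lemma (in finite_content) almost_all_conj_ex:
  assumes "almost_all M \<mu> \<epsilon> X P" "almost_all M \<mu> \<delta> X Q" "X \<in> M" "0 < \<mu> X" "\<epsilon> + \<delta> < 1"
  shows "\<exists>a\<in>X. P a \<and> Q a"
proof (rule ccontr)
  assume neg: "\<not> ?thesis"
  obtain E where E: "E \<in> M" "\<mu> E \<le> \<epsilon> * \<mu> X" "\<forall>a\<in>X - E. P a"
    using assms(1) unfolding almost_all_def by blast
  obtain F where F: "F \<in> M" "\<mu> F \<le> \<delta> * \<mu> X" "\<forall>a\<in>X - F. Q a"
    using assms(2) unfolding almost_all_def by blast
  have "X \<subseteq> E \<union> F" using neg E(3) F(3) by blast
  then have "\<mu> X \<le> \<mu> E + \<mu> F"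
    using content_mono[OF assms(3) Un[OF E(1) F(1)]] content_Un_le[OF E(1) F(1)] by simp
  also have "\<dots> \<le> (\<epsilon> + \<delta>) * \<mu> X" using E(2) F(2) by (simp add: algebra_simps)
  also have "\<dots> < 1 * \<mu> X" using assms(4,5) by (rule mult_strict_right_mono[rotated])
  finally show False by simp
qed

text \<open>A point \<open>a\<close> good for both alternatives is found first, then a point
  \<open>b\<close> at which \<open>P a b\<close> and its negation both hold.\<close>

lemma almost_all_pairs_exclusive:
  assumes "finite_content V D \<mu>" "finite_content W D' \<nu>"
    and X: "X \<in> D" "0 < \<mu> X" and Y: "Y \<in> D'" "0 < \<nu> Y" and "\<epsilon> + \<delta> < 1"
    and "almost_all_pairs D \<mu> D' \<nu> \<epsilon> X Y P" "almost_all_pairs D \<mu> D' \<nu> \<delta> X Y (\<lambda>a b. \<not> P a b)"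
  shows False
proof -
  obtain a where "almost_all D' \<nu> \<epsilon> Y (P a)" "almost_all D' \<nu> \<delta> Y (\<lambda>b. \<not> P a b)"
    using finite_content.almost_all_conj_ex[OF assms(1) _ _ X \<open>\<epsilon> + \<delta> < 1\<close>] assms(8,9)
    unfolding almost_all_pairs_def by blast
  then show False
    using finite_content.almost_all_conj_ex[OF assms(2) _ _ Y \<open>\<epsilon> + \<delta> < 1\<close>] by blast
qed

text \<open>Every exceptional set has the form \<open>X - Z\<close> with \<open>Z\<close> in the
  type of the piece. For pieces with types \<open>p\<close> and \<open>q\<close>, points of
  \<open>?e\<close> have their fibres in \<open>q\<close> and points of \<open>?d\<close> have
  theirs in \<open>p\<close>.\<close>

theorem stable_regularity:
  assumes st: "stable_rel V W R"
    and \<mu>: "finite_content V D \<mu>" "0 < \<mu> V" "fiber_algebra V W R \<subseteq> D"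
    and \<nu>: "finite_content W D' \<nu>" "0 < \<nu> W" "fiber_algebra W V (R\<inverse>) \<subseteq> D'"
    and \<epsilon>: "0 < \<epsilon>"
  shows "\<exists>P Q. finite P \<and> partition_on V P \<and> P \<subseteq> fiber_algebra V W R \<and> (\<forall>X\<in>P. 0 < \<mu> X) \<and>
      finite Q \<and> partition_on W Q \<and> Q \<subseteq> fiber_algebra W V (R\<inverse>) \<and> (\<forall>Y\<in>Q. 0 < \<nu> Y) \<and>
      (\<forall>X\<in>P. \<forall>Y\<in>Q. almost_all_pairs D \<mu> D' \<nu> \<epsilon> X Y (\<lambda>a b. (a, b) \<in> R) \<or>
         almost_all_pairs D \<mu> D' \<nu> \<epsilon> X Y (\<lambda>a b. (a, b) \<notin> R))"
proof -
  let ?A = "fiber_algebra V W R" and ?B = "fiber_algebra W V (R\<inverse>)"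
  have ne: "V \<noteq> {}" "W \<noteq> {}"
    using \<mu>(2) \<nu>(2) finite_content.content_empty[OF \<mu>(1)] finite_content.content_empty[OF \<nu>(1)] by auto
  interpret V: finite_content V ?A \<mu>
    using finite_content.content_subalgebra[OF \<mu>(1) algebra_fiber_algebra[OF ne(2)] \<mu>(3)] .
  interpret W: finite_content W ?B \<nu>
    using finite_content.content_subalgebra[OF \<nu>(1) algebra_fiber_algebra[OF ne(1)] \<nu>(3)] .
  obtain P where P: "finite P" "partition_on V P" "\<And>X. X \<in> P \<Longrightarrow> X \<in> ?A \<and> 0 < \<mu> X \<and>
      (\<exists>p. ultrafilter_on V ?A p \<and> X \<in> p \<and> (\<forall>Z\<in>p. \<mu> (X - Z) \<le> \<epsilon> * \<mu> X))"
    using V.ultrafilter_partition[OF stable_rel_atom[OF st ne(2)] \<mu>(2) \<epsilon>] by blast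
  obtain Q where Q: "finite Q" "partition_on W Q" "\<And>Y. Y \<in> Q \<Longrightarrow> Y \<in> ?B \<and> 0 < \<nu> Y \<and>
      (\<exists>q. ultrafilter_on W ?B q \<and> Y \<in> q \<and> (\<forall>Z\<in>q. \<nu> (Y - Z) \<le> \<epsilon> * \<nu> Y))"
    using W.ultrafilter_partition[OF stable_rel_atom[OF stable_rel_converse[OF st] ne(1)] \<nu>(2) \<epsilon>] by blast
  have "almost_all_pairs D \<mu> D' \<nu> \<epsilon> X Y (\<lambda>a b. (a, b) \<in> R) \<or>
      almost_all_pairs D \<mu> D' \<nu> \<epsilon> X Y (\<lambda>a b. (a, b) \<notin> R)" if XP: "X \<in> P" and YQ: "Y \<in> Q" for X Y
  proof -
    obtain p where p: "ultrafilter_on V ?A p" "\<And>Z. Z \<in> p \<Longrightarrow> \<mu> (X - Z) \<le> \<epsilon> * \<mu> X" and X: "X \<in> ?A"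
      using P(3)[OF XP] by blast
    obtain q where q: "ultrafilter_on W ?B q" "\<And>Z. Z \<in> q \<Longrightarrow> \<nu> (Y - Z) \<le> \<epsilon> * \<nu> Y" and Y: "Y \<in> ?B"
      using Q(3)[OF YQ] by blast
    have aaX: "almost_all D \<mu> \<epsilon> X \<phi>" if "Z \<in> p" "\<And>a. a \<in> X \<inter> Z \<Longrightarrow> \<phi> a" for \<phi> Z
    proof -
      have "X - Z \<in> ?A" using X that(1) p(1) by (auto simp: ultrafilter_on_def)
      then show ?thesis using p(2)[OF that(1)] that(2) \<mu>(3) unfolding almost_all_def by blast
    qed
    have aaY: "almost_all D' \<nu> \<epsilon> Y \<phi>" if "Z \<in> q" "\<And>b. b \<in> Y \<inter> Z \<Longrightarrow> \<phi> b" for \<phi> Z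
    proof -
      have "Y - Z \<in> ?B" using Y that(1) q(1) by (auto simp: ultrafilter_on_def)
      then show ?thesis using q(2)[OF that(1)] that(2) \<nu>(3) unfolding almost_all_def by blast
    qed
    let ?d = "defining_set V W R p" and ?e = "defining_set W V (R\<inverse>) q"
    have dB: "?d \<in> ?B" using defining_set_in_fiber_algebra[OF st ne p(1)] .
    have eA: "?e \<in> ?A"
      using defining_set_in_fiber_algebra[OF stable_rel_converse[OF st] ne(2,1) q(1)] by simp
    \<comment> \<open>Symmetry forces the two orders of quantification to select the same
      alternative.\<close>
    have sym: "?e \<in> p \<longleftrightarrow> ?d \<in> q"
      using defining_set_symmetric[OF st ne p(1) q(1)]
        defining_set_symmetric[OF stable_rel_converse[OF st] ne(2,1) q(1)] p(1) by auto
    have fibX: "V - fiber V R b \<in> p" if "b \<in> W - ?d" for b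
      using that V.ultrafilter_compl_iff[OF p(1) fiber_in_fiber_algebra] by (simp add: defining_set_def)
    have fibY: "W - fiber W (R\<inverse>) a \<in> q" if "a \<in> V - ?e" for a
      using that W.ultrafilter_compl_iff[OF q(1) fiber_in_fiber_algebra] by (simp add: defining_set_def)
    show ?thesis
    proof (cases "?e \<in> p")
      case True
      have "almost_all D' \<nu> \<epsilon> Y (\<lambda>b. (a, b) \<in> R)" if "a \<in> ?e" for a
        by (rule aaY[of "fiber W (R\<inverse>) a"]) (use that in \<open>auto simp: defining_set_def fiber_def\<close>)
      moreover have "almost_all D \<mu> \<epsilon> X (\<lambda>a. (a, b) \<in> R)" if "b \<in> ?d" for b
        by (rule aaX[of "fiber V R b"]) (use that in \<open>auto simp: defining_set_def fiber_def\<close>)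
      ultimately have "almost_all_pairs D \<mu> D' \<nu> \<epsilon> X Y (\<lambda>a b. (a, b) \<in> R)"
        using aaX[OF True] aaY[of ?d] True sym unfolding almost_all_pairs_def by simp
      then show ?thesis ..
    next
      case False
      then have e: "V - ?e \<in> p" and d: "W - ?d \<in> q"
        using sym V.ultrafilter_compl_iff[OF p(1) eA] W.ultrafilter_compl_iff[OF q(1) dB] by simp_all
      have "almost_all D' \<nu> \<epsilon> Y (\<lambda>b. (a, b) \<notin> R)" if "a \<in> V - ?e" for a
        by (rule aaY[OF fibY[OF that]]) (auto simp: fiber_def)
      moreover have "almost_all D \<mu> \<epsilon> X (\<lambda>a. (a, b) \<notin> R)" if "b \<in> W - ?d" for b
        by (rule aaX[OF fibX[OF that]]) (auto simp: fiber_def)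
      ultimately have "almost_all_pairs D \<mu> D' \<nu> \<epsilon> X Y (\<lambda>a b. (a, b) \<notin> R)"
        using aaX[OF e] aaY[OF d] unfolding almost_all_pairs_def by simp
      then show ?thesis ..
    qed
  qed
  moreover have "P \<subseteq> ?A \<and> (\<forall>X\<in>P. 0 < \<mu> X)" "Q \<subseteq> ?B \<and> (\<forall>Y\<in>Q. 0 < \<nu> Y)"
    using P(3) Q(3) by blast+
  ultimately show ?thesis using P(1,2) Q(1,2) by (intro exI[of _ P] exI[of _ Q]) simp
qed

section \<open>Definable sets\<close>

lemma tm_val_cong:
  "(\<And>i. i \<in> tm_vars t \<Longrightarrow> e i = e' i) \<Longrightarrow> tm_val M e t = tm_val M e' t"
proof (induction t)
  case (App f ts)
  then have "map (tm_val M e) ts = map (tm_val M e') ts" by (intro map_cong) auto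
  then show ?case by (simp only: tm_val.simps)
qed simp_all

lemma sat_cong:
  "(\<And>i. i \<in> free_vars \<phi> \<Longrightarrow> e i = e' i) \<Longrightarrow> sat M e \<phi> \<longleftrightarrow> sat M e' \<phi>"
proof (induction \<phi> arbitrary: e e')
  case (Equal s t)
  then have "tm_val M e s = tm_val M e' s" "tm_val M e t = tm_val M e' t" by (auto intro!: tm_val_cong)
  then show ?case by simp
next
  case (Rel r ts)
  then have "map (tm_val M e) ts = map (tm_val M e') ts" by (intro map_cong refl tm_val_cong) auto
  then show ?case by (simp only: sat.simps)
next
  case (Neg \<phi>)
  have "sat M e \<phi> \<longleftrightarrow> sat M e' \<phi>" by (rule Neg.IH) (use Neg.prems in simp)
  then show ?case by simp
next
  case (Conj \<phi> \<psi>)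
  have "sat M e \<phi> \<longleftrightarrow> sat M e' \<phi>" "sat M e \<psi> \<longleftrightarrow> sat M e' \<psi>"
    by (rule Conj.IH; use Conj.prems in simp)+
  then show ?case by simp
next
  case (Exi i \<phi>)
  have "sat M (e(i := a)) \<phi> \<longleftrightarrow> sat M (e'(i := a)) \<phi>" for a
    by (rule Exi.IH) (use Exi.prems in auto)
  then show ?case by simp
qed

fun rename_tm :: "(nat \<Rightarrow> nat) \<Rightarrow> ('f, 'm) tm \<Rightarrow> ('f, 'm) tm" where
  "rename_tm \<pi> (Var i) = Var (\<pi> i)"
| "rename_tm \<pi> (Param a) = Param a"
| "rename_tm \<pi> (App f ts) = App f (map (rename_tm \<pi>) ts)"

text \<open>Bound variables are renamed as well, which is harmless for injective \<open>\<pi>\<close>.\<close>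

fun rename_fm :: "(nat \<Rightarrow> nat) \<Rightarrow> ('f, 'r, 'm) fm \<Rightarrow> ('f, 'r, 'm) fm" where
  "rename_fm \<pi> (Equal s t) = Equal (rename_tm \<pi> s) (rename_tm \<pi> t)"
| "rename_fm \<pi> (Rel r ts) = Rel r (map (rename_tm \<pi>) ts)"
| "rename_fm \<pi> (Neg \<phi>) = Neg (rename_fm \<pi> \<phi>)"
| "rename_fm \<pi> (Conj \<phi> \<psi>) = Conj (rename_fm \<pi> \<phi>) (rename_fm \<pi> \<psi>)"
| "rename_fm \<pi> (Exi i \<phi>) = Exi (\<pi> i) (rename_fm \<pi> \<phi>)"

lemma tm_val_rename: "tm_val M e (rename_tm \<pi> t) = tm_val M (e \<circ> \<pi>) t"
proof (induction t)
  case (App f ts)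
  then have "map (tm_val M e \<circ> rename_tm \<pi>) ts = map (tm_val M (e \<circ> \<pi>)) ts"
    by (intro map_cong refl) (simp add: comp_def)
  then show ?case by (simp only: rename_tm.simps tm_val.simps map_map)
qed simp_all

lemma sat_rename:
  assumes "inj \<pi>"
  shows "sat M e (rename_fm \<pi> \<phi>) \<longleftrightarrow> sat M (e \<circ> \<pi>) \<phi>"
proof (induction \<phi> arbitrary: e)
  case (Equal s t)
  show ?case by (simp only: rename_fm.simps sat.simps tm_val_rename)
next
  case (Rel r ts)
  have "map (tm_val M e \<circ> rename_tm \<pi>) ts = map (tm_val M (e \<circ> \<pi>)) ts"
    by (intro map_cong refl) (simp only: comp_apply tm_val_rename)
  then show ?case by (simp only: rename_fm.simps sat.simps map_map)
next
  case (Neg \<phi>)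
  show ?case by (simp only: rename_fm.simps sat.simps Neg.IH)
next
  case (Conj \<phi> \<psi>)
  show ?case by (simp only: rename_fm.simps sat.simps Conj.IH)
next
  case (Exi i \<phi>)
  \<comment> \<open>Injectivity of \<open>\<pi>\<close> ensures that assigning the renamed bound
    variable affects no other variable.\<close>
  have "e(\<pi> i := a) \<circ> \<pi> = (e \<circ> \<pi>)(i := a)" for a
    using assms by (auto simp: fun_eq_iff inj_eq)
  then show ?case by (simp only: rename_fm.simps sat.simps Exi.IH)
qed

lemma wf_tm_rename: "wf_tm L (rename_tm \<pi> t) \<longleftrightarrow> wf_tm L t"
  by (induction t) auto

lemma tm_params_rename: "tm_params (rename_tm \<pi> t) = tm_params t"
  by (induction t) auto

lemma tm_vars_rename: "tm_vars (rename_tm \<pi> t) = \<pi> ` tm_vars t"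
  by (induction t) auto

lemma wf_fm_rename: "wf_fm L (rename_fm \<pi> \<phi>) \<longleftrightarrow> wf_fm L \<phi>"
  by (induction \<phi>) (simp_all add: wf_tm_rename)

lemma params_rename: "params (rename_fm \<pi> \<phi>) = params \<phi>"
  by (induction \<phi>) (simp_all add: tm_params_rename)

lemma free_vars_rename: "inj \<pi> \<Longrightarrow> free_vars (rename_fm \<pi> \<phi>) = \<pi> ` free_vars \<phi>"
  by (induction \<phi>) (simp_all add: tm_vars_rename image_Un image_UN image_set_diff)

section \<open>Closure properties of definable sets\<close>

lemma definableE:
  assumes "definable L M n X"
  obtains \<phi> where "wf_fm L \<phi>" "params \<phi> \<subseteq> univ M" "free_vars \<phi> \<subseteq> {..<n}"
    "X = {a. length a = n \<and> set a \<subseteq> univ M \<and> sat M (\<lambda>i. a ! i) \<phi>}"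
proof -
  obtain \<phi> where "\<phi> \<in> formulas_over L (univ M) n"
    "X = {a. length a = n \<and> set a \<subseteq> univ M \<and> sat M (\<lambda>i. a ! i) \<phi>}"
    using assms unfolding definable_def by (rule bexE)
  then show thesis by (intro that[of \<phi>]) (simp_all add: formulas_over_def)
qed

lemma definableI:
  assumes "wf_fm L \<phi>" "params \<phi> \<subseteq> univ M" "free_vars \<phi> \<subseteq> {..<n}"
    "X = {a. length a = n \<and> set a \<subseteq> univ M \<and> sat M (\<lambda>i. a ! i) \<phi>}"
  shows "definable L M n X"
  unfolding definable_def by (rule bexI[of _ \<phi>]) (use assms in \<open>simp_all add: formulas_over_def\<close>)

lemma definable_tuple:
  assumes "definable L M n X" "a \<in> X"
  shows "length a = n" "set a \<subseteq> univ M"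
proof -
  from assms(1) obtain \<phi> where "X = {a. length a = n \<and> set a \<subseteq> univ M \<and> sat M (\<lambda>i. a ! i) \<phi>}"
    by (rule definableE)
  with assms(2) show "length a = n" "set a \<subseteq> univ M" by simp_all
qed

lemma definable_Int:
  assumes "definable L M n X" "definable L M n Y"
  shows "definable L M n (X \<inter> Y)"
proof -
  obtain \<phi> where \<phi>: "wf_fm L \<phi>" "params \<phi> \<subseteq> univ M" "free_vars \<phi> \<subseteq> {..<n}"
    "X = {a. length a = n \<and> set a \<subseteq> univ M \<and> sat M (\<lambda>i. a ! i) \<phi>}"
    using assms(1) by (rule definableE)
  obtain \<psi> where \<psi>: "wf_fm L \<psi>" "params \<psi> \<subseteq> univ M" "free_vars \<psi> \<subseteq> {..<n}"
    "Y = {a. length a = n \<and> set a \<subseteq> univ M \<and> sat M (\<lambda>i. a ! i) \<psi>}"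
    using assms(2) by (rule definableE)
  show ?thesis by (rule definableI[of _ "Conj \<phi> \<psi>"]) (use \<phi> \<psi> in auto)
qed

lemma definable_Diff:
  assumes "definable L M n X" "definable L M n Y"
  shows "definable L M n (X - Y)"
proof -
  obtain \<phi> where \<phi>: "wf_fm L \<phi>" "params \<phi> \<subseteq> univ M" "free_vars \<phi> \<subseteq> {..<n}"
    "X = {a. length a = n \<and> set a \<subseteq> univ M \<and> sat M (\<lambda>i. a ! i) \<phi>}"
    using assms(1) by (rule definableE)
  obtain \<psi> where \<psi>: "wf_fm L \<psi>" "params \<psi> \<subseteq> univ M" "free_vars \<psi> \<subseteq> {..<n}"
    "Y = {a. length a = n \<and> set a \<subseteq> univ M \<and> sat M (\<lambda>i. a ! i) \<psi>}"
    using assms(2) by (rule definableE)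
  show ?thesis by (rule definableI[of _ "Conj \<phi> (Neg \<psi>)"]) (use \<phi> \<psi> in auto)
qed

lemma algebra_definable_subsets:
  assumes V: "definable L M n V"
  shows "algebra V (definable_subsets L M n V)"
  unfolding algebra_iff_Int
proof (intro conjI ballI)
  show "{} \<in> definable_subsets L M n V"
    using definable_Diff[OF V V] by (simp add: definable_subsets_def)
qed (use V in \<open>auto simp: definable_subsets_def definable_Int definable_Diff\<close>)

text \<open>Instead of substituting \<open>c\<close> into \<open>\<phi>\<close>, the last variable
  is quantified and equated with \<open>c\<close>; as \<open>c\<close> lies in the universe, it is
  an available witness.\<close>

lemma definable_fix_last:
  assumes "definable L M (Suc m) X" "c \<in> univ M"
  shows "definable L M m {a. a @ [c] \<in> X}"
proof -
  obtain \<phi> where \<phi>: "wf_fm L \<phi>" "params \<phi> \<subseteq> univ M" "free_vars \<phi> \<subseteq> {..<Suc m}"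
    "X = {a. length a = Suc m \<and> set a \<subseteq> univ M \<and> sat M (\<lambda>i. a ! i) \<phi>}"
    using assms(1) by (rule definableE)
  have "sat M ((\<lambda>i. a ! i)(m := c)) \<phi> \<longleftrightarrow> sat M (\<lambda>i. (a @ [c]) ! i) \<phi>" if "length a = m" for a
    by (rule sat_cong) (use \<phi>(3) that in \<open>auto simp: nth_append\<close>)
  then have "{a. a @ [c] \<in> X} = {a. length a = m \<and> set a \<subseteq> univ M \<and>
      sat M (\<lambda>i. a ! i) (Exi m (Conj (Equal (Var m) (Param c)) \<phi>))}"
    using assms(2) \<phi>(4) by auto
  then show ?thesis
    by (rule definableI[rotated 3]) (use \<phi> assms(2) in auto)
qed

lemma definable_fix_suffix:
  "definable L M (n + length b) X \<Longrightarrow> set b \<subseteq> univ M \<Longrightarrow> definable L M n {a. a @ b \<in> X}"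
proof (induction b arbitrary: X rule: rev_induct)
  case (snoc c b)
  have "definable L M (n + length b) {a. a @ [c] \<in> X}"
    by (rule definable_fix_last) (use snoc.prems in auto)
  from snoc.IH[OF this] show ?case using snoc.prems(2) by simp
qed simp

lemma definable_swap:
  assumes "definable L M (n + k) X"
  shows "definable L M (k + n) {c. length c = k + n \<and> drop k c @ take k c \<in> X}"
proof -
  obtain \<phi> where \<phi>: "wf_fm L \<phi>" "params \<phi> \<subseteq> univ M" "free_vars \<phi> \<subseteq> {..<n + k}"
    "X = {a. length a = n + k \<and> set a \<subseteq> univ M \<and> sat M (\<lambda>i. a ! i) \<phi>}"
    using assms(1) by (rule definableE)
  \<comment> \<open>The two blocks of variables change places. Beyond them \<open>\<pi>\<close> is
    the identity, since injectivity is required on bound variables as well.\<close>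
  define \<pi> where "\<pi> i = (if i < n then i + k else if i < n + k then i - n else i)" for i
  have inj: "inj \<pi>" by (rule injI) (auto simp: \<pi>_def split: if_splits)
  have "sat M ((\<lambda>i. c ! i) \<circ> \<pi>) \<phi> \<longleftrightarrow> sat M (\<lambda>i. (drop k c @ take k c) ! i) \<phi>" if "length c = k + n" for c
    by (rule sat_cong) (use \<phi>(3) that in \<open>auto simp: \<pi>_def nth_append add.commute\<close>)
  moreover have "set (drop k c @ take k c) = set c" for c :: "'c list"
    by (metis append_take_drop_id set_append sup_commute)
  ultimately have "{c. length c = k + n \<and> drop k c @ take k c \<in> X} = {c. length c = k + n \<and> set c \<subseteq> univ M \<and>
      sat M (\<lambda>i. c ! i) (rename_fm \<pi> \<phi>)}"
    unfolding \<phi>(4) by (auto simp: sat_rename[OF inj])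
  moreover have "\<pi> ` free_vars \<phi> \<subseteq> {..<k + n}" using \<phi>(3) by (auto simp: \<pi>_def)
  ultimately show ?thesis
    by (intro definableI) (use \<phi> in \<open>auto simp: wf_fm_rename params_rename free_vars_rename inj\<close>)
qed

lemma definable_fiber:
  assumes W: "definable L M k W" and R: "definable_rel L M n k R" and "R \<subseteq> V \<times> W" "b \<in> W"
  shows "fiber V R b \<in> definable_subsets L M n V"
proof -
  have len: "length a = n" "length c = k" if "(a, c) \<in> R" for a c
    using R that by (auto simp: definable_rel_def)
  have b: "length b = k" "set b \<subseteq> univ M" using definable_tuple[OF W \<open>b \<in> W\<close>] by simp_all
  have "fiber V R b = {a. a @ b \<in> {a @ b |a b. (a, b) \<in> R}}"
  proof (intro subset_antisym subsetI)
    fix a assume "a \<in> {a. a @ b \<in> {a @ b |a b. (a, b) \<in> R}}"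
    then obtain a' b' where ab: "(a', b') \<in> R" "a @ b = a' @ b'" by blast
    then have "a = a' \<and> b = b'" using len(2)[OF ab(1)] b(1) by simp
    then show "a \<in> fiber V R b" using ab(1) assms(3) by (auto simp: fiber_def)
  qed (auto simp: fiber_def)
  also have "definable L M n \<dots>"
    by (rule definable_fix_suffix) (use R b in \<open>auto simp: definable_rel_def\<close>)
  finally show ?thesis by (auto simp: definable_subsets_def fiber_def)
qed

text \<open>This lets the results on fibres in \<open>V\<close> be reused for fibres in
  \<open>W\<close>.\<close>

lemma definable_rel_converse:
  assumes "definable_rel L M n k R"
  shows "definable_rel L M k n (R\<inverse>)"
proof -
  have len: "length a = n" "length b = k" if "(a, b) \<in> R" for a b
    using assms that by (auto simp: definable_rel_def)
  have "{b @ a |b a. (b, a) \<in> R\<inverse>} =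
      {c. length c = k + n \<and> drop k c @ take k c \<in> {a @ b |a b. (a, b) \<in> R}}" (is "?L = ?R")
  proof (intro subset_antisym subsetI)
    fix c assume "c \<in> ?L"
    then obtain a b where "(a, b) \<in> R" "c = b @ a" by auto
    then show "c \<in> ?R" using len by fastforce
  next
    fix c assume "c \<in> ?R"
    then obtain a b where ab: "(a, b) \<in> R" "drop k c @ take k c = a @ b" "length c = k + n" by blast
    then have "drop k c = a \<and> take k c = b" using len[OF ab(1)] by simp
    then have "c = b @ a" by (metis append_take_drop_id)
    then show "c \<in> ?L" using ab(1) by blast
  qed
  also have "definable L M (k + n) \<dots>"
    by (rule definable_swap) (use assms in \<open>simp add: definable_rel_def\<close>)
  finally show ?thesis using len by (auto simp: definable_rel_def)
qed

lemma fiber_algebra_definable: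
  assumes "definable L M n V" "definable L M k W" "definable_rel L M n k R" "R \<subseteq> V \<times> W"
  shows "fiber_algebra V W R \<subseteq> definable_subsets L M n V"
  unfolding fiber_algebra_def
  by (rule boolean_combinations_least[OF algebra_definable_subsets[OF assms(1)]])
    (use definable_fiber[OF assms(2-4)] in \<open>simp add: image_subset_iff\<close>)

lemma finite_content_keisler_measure:
  assumes "definable L M n V" "keisler_measure L M n V \<mu>"
  shows "finite_content V (definable_subsets L M n V) \<mu>"
  using algebra_definable_subsets[OF assms(1)] assms(2)
  by (simp add: finite_content_def finite_content_axioms_def keisler_measure_def)

text \<open>For \<open>\<epsilon> \<ge> 1\<close> the pieces themselves are admissible exceptional
  sets and both alternatives hold, so exclusion is asserted for \<open>\<epsilon> < 1\<close>. It
  relies on all pieces having positive measure.\<close>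

theorem theorem1p1:
  fixes L :: "('f, 'r) language" and M :: "('f, 'r, 'm) struct"
    and n k :: nat and V W :: "'m list set" and R :: "('m list \<times> 'm list) set"
    and \<mu> \<nu> :: "'m list set \<Rightarrow> real" and \<epsilon> :: real
  assumes "is_structure L M" and "saturated L M"
    and "definable L M n V" and "definable L M k W"
    and "definable_rel L M n k R" and "R \<subseteq> V \<times> W"
    and "stable_rel V W R"
    and "keisler_measure L M n V \<mu>" and "keisler_measure L M k W \<nu>"
    and "\<epsilon> > 0"
  shows "\<exists>P Q. finite P \<and> partition_on V P \<and>
      (\<forall>X\<in>P. X \<in> definable_subsets L M n V \<and> X \<in> Delta_sets V W R) \<and>
      finite Q \<and> partition_on W Q \<and>
      (\<forall>Y\<in>Q. Y \<in> definable_subsets L M k W \<and> Y \<in> Delta_star_sets V W R) \<and>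
      (\<forall>X\<in>P. \<forall>Y\<in>Q.
        let pos = almost_all_pairs (definable_subsets L M n V) \<mu> (definable_subsets L M k W) \<nu> \<epsilon> X Y
                    (\<lambda>a b. (a, b) \<in> R);
            neg = almost_all_pairs (definable_subsets L M n V) \<mu> (definable_subsets L M k W) \<nu> \<epsilon> X Y
                    (\<lambda>a b. (a, b) \<notin> R)
        in (pos \<or> neg) \<and> (\<epsilon> < 1 \<longrightarrow> \<not> (pos \<and> neg)))"
proof -
  let ?D = "definable_subsets L M n V" and ?D' = "definable_subsets L M k W"
  have \<mu>: "finite_content V ?D \<mu>" "0 < \<mu> V"
    using finite_content_keisler_measure[OF assms(3,8)] assms(8) by (simp_all add: keisler_measure_def)
  have \<nu>: "finite_content W ?D' \<nu>" "0 < \<nu> W"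
    using finite_content_keisler_measure[OF assms(4,9)] assms(9) by (simp_all add: keisler_measure_def)
  have A: "fiber_algebra V W R \<subseteq> ?D"
    using assms(3-6) by (rule fiber_algebra_definable)
  have B: "fiber_algebra W V (R\<inverse>) \<subseteq> ?D'"
    by (rule fiber_algebra_definable[OF assms(4,3) definable_rel_converse[OF assms(5)]]) (use assms(6) in blast)
  have \<Delta>: "fiber_algebra V W R \<subseteq> Delta_sets V W R" "fiber_algebra W V (R\<inverse>) \<subseteq> Delta_star_sets V W R"
    unfolding fiber_algebra_def Delta_sets_def Delta_star_sets_def
    by (rule boolean_combinations_mono; auto simp: fiber_def)+
  \<comment> \<open>For \<open>\<epsilon> < 1\<close> the two alternatives at level \<open>\<epsilon>\<close> exclude each other once one of them holds at a
    level \<open>\<delta> < 1 - \<epsilon>\<close>.\<close>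
  define \<delta> where "\<delta> = (if \<epsilon> < 1 then min \<epsilon> ((1 - \<epsilon>) / 2) else \<epsilon>)"
  have \<delta>: "0 < \<delta>" "\<delta> \<le> \<epsilon>" "\<epsilon> < 1 \<Longrightarrow> \<delta> + \<epsilon> < 1"
    using assms(10) by (auto simp: \<delta>_def min_def field_simps)
  obtain P Q where P: "finite P" "partition_on V P" "P \<subseteq> fiber_algebra V W R" "\<forall>X\<in>P. 0 < \<mu> X"
    and Q: "finite Q" "partition_on W Q" "Q \<subseteq> fiber_algebra W V (R\<inverse>)" "\<forall>Y\<in>Q. 0 < \<nu> Y"
    and reg: "\<And>X Y. X \<in> P \<Longrightarrow> Y \<in> Q \<Longrightarrow> almost_all_pairs ?D \<mu> ?D' \<nu> \<delta> X Y (\<lambda>a b. (a, b) \<in> R) \<or>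
         almost_all_pairs ?D \<mu> ?D' \<nu> \<delta> X Y (\<lambda>a b. (a, b) \<notin> R)"
    using stable_regularity[OF assms(7) \<mu> A \<nu> B \<delta>(1)] by blast
  have "let pos = almost_all_pairs ?D \<mu> ?D' \<nu> \<epsilon> X Y (\<lambda>a b. (a, b) \<in> R);
            neg = almost_all_pairs ?D \<mu> ?D' \<nu> \<epsilon> X Y (\<lambda>a b. (a, b) \<notin> R)
        in (pos \<or> neg) \<and> (\<epsilon> < 1 \<longrightarrow> \<not> (pos \<and> neg))" if "X \<in> P" "Y \<in> Q" for X Y
  proof -
    have X: "X \<in> ?D" "0 < \<mu> X" and Y: "Y \<in> ?D'" "0 < \<nu> Y" using that P(3,4) Q(3,4) A B by blast+
    have "almost_all_pairs ?D \<mu> ?D' \<nu> \<epsilon> X Y S" if "almost_all_pairs ?D \<mu> ?D' \<nu> \<delta> X Y S" for S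
      using almost_all_pairs_mono[OF that \<delta>(2)] X(2) Y(2) by simp
    \<comment> \<open>One alternative already holds at level \<open>\<delta>\<close>; the opposite
      one at level \<open>\<epsilon>\<close> contradicts it because
      \<open>\<delta> + \<epsilon> < 1\<close>.\<close>
    moreover have False if "\<epsilon> < 1" "almost_all_pairs ?D \<mu> ?D' \<nu> \<epsilon> X Y (\<lambda>a b. (a, b) \<in> R)"
      "almost_all_pairs ?D \<mu> ?D' \<nu> \<epsilon> X Y (\<lambda>a b. (a, b) \<notin> R)"
      using reg[OF \<open>X \<in> P\<close> \<open>Y \<in> Q\<close>] that(2,3)
        almost_all_pairs_exclusive[OF \<mu>(1) \<nu>(1) X Y \<delta>(3)[OF that(1)], where P = "\<lambda>a b. (a, b) \<in> R"]
        almost_all_pairs_exclusive[OF \<mu>(1) \<nu>(1) X Y \<delta>(3)[OF that(1)], where P = "\<lambda>a b. (a, b) \<notin> R"]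
      by auto
    ultimately show ?thesis using reg[OF that] unfolding Let_def by blast
  qed
  with P(1-3) Q(1-3) A B \<Delta> show ?thesis by (intro exI[of _ P] exI[of _ Q]) blast
qed

end
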